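(* For every $n\ge 3$ there exist convex centrally symmetric bodies $K,L$ in the hyperbolic space $\mathbb{H}^n$ (symmetric about a common point $o$) such that $$\mathrm{vol}_{n-1}(K\cap H)\le \mathrm{vol}_{n-1}(L\cap H)$$ for every totally geodesic hyperplane $H$ of $\mathbb{H}^n$ passing through $o$, but $\mathrm{vol}_n(K)>\mathrm{vol}_n(L)$.
   Context: $\mathbb{H}^n$ is realized as the Poincaré ball: the open unit ball $B^n\subset\mathbb{R}^n$ with metric $ds^2=4\frac{dx_1^2+\cdots+dx_n^2}{(1-|x|^2)^2}$, with $o$ the origin. A body is a compact set with non-empty interior; it is convex if for any two of its points the geodesic segment of this metric joining them lies in the body. Centrally symmetric means $K=-K$ in this model. The totally geodesic hyperplanes through $o$ are $\{x:\langle x,\xi\rangle=0\}\cap B^n$, $\xi\in S^{n-1}$. $\mathrm{vol}_n,\mathrm{vol}_{n-1}$ are the Riemannian volumes of the hyperbolic metric. *)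

theory Defs
  imports "HOL-Analysis.Analysis"
begin

text \<open>Poincare ball model of hyperbolic n-space, points are vectors in real^'n
  with norm < 1; the metric is ds^2 = 4 |dx|^2 / (1 - |x|^2)^2.\<close>

definition hdist :: "real^'n \<Rightarrow> real^'n \<Rightarrow> real" where
  "hdist x y = arcosh (1 + 2 * (norm (x - y))\<^sup>2 / ((1 - (norm x)\<^sup>2) * (1 - (norm y)\<^sup>2)))"

text \<open>Geodesic segment joining x and y (hyperbolic space is uniquely geodesic,
  so this is exactly the image of the geodesic from x to y).\<close>
definition hsegment :: "real^'n \<Rightarrow> real^'n \<Rightarrow> (real^'n) set" where
  "hsegment x y = {z. norm z < 1 \<and> hdist x z + hdist z y = hdist x y}"

definition hbody :: "(real^'n) set \<Rightarrow> bool" where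
  "hbody K \<longleftrightarrow> compact K \<and> K \<subseteq> ball 0 1 \<and> interior K \<noteq> {}"

definition hconvex :: "(real^'n) set \<Rightarrow> bool" where
  "hconvex K \<longleftrightarrow> (\<forall>x\<in>K. \<forall>y\<in>K. hsegment x y \<subseteq> K)"

definition centrally_symmetric :: "(real^'n) set \<Rightarrow> bool" where
  "centrally_symmetric K \<longleftrightarrow> uminus ` K = K"

definition hvol :: "(real^'n) set \<Rightarrow> real" where
  "hvol K = integral K (\<lambda>x. (2 / (1 - (norm x)\<^sup>2)) ^ CARD('n))"

text \<open>Riemannian (n-1)-volume of K \<inter> H, H = {x. x \<bullet> xi = 0} with xi a unit vector.
  The (n-1)-dimensional Lebesgue measure on the hyperplane H is realised as the
  n-dimensional Lebesgue measure of the unit-height cylinder over the set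
  (Fubini in an orthonormal frame adapted to H); x - (x \<bullet> xi) *R xi is the
  orthogonal projection of x onto H.\<close>
definition hsection_vol :: "(real^'n) set \<Rightarrow> real^'n \<Rightarrow> real" where
  "hsection_vol K xi =
     integral {x. 0 \<le> x \<bullet> xi \<and> x \<bullet> xi \<le> 1 \<and> x - (x \<bullet> xi) *\<^sub>R xi \<in> K}
       (\<lambda>x. (2 / (1 - (norm (x - (x \<bullet> xi) *\<^sub>R xi))\<^sup>2)) ^ (CARD('n) - 1))"

end

theory Submission
  imports Defs
begin

text \<open>In the Klein model geodesics are chords, so hyperbolic convexity is Euclidean convexity
  there. Take for \<open>L\<close> a ball of radius \<open>s\<close> close to 1, cut by the half-spaces tangent to a
  smaller ball at the points of latitude at most \<open>3/5\<close>: this leaves a long barrel which reaches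
  the sphere of radius \<open>s\<close> around both poles. \<open>K\<close> arises from \<open>L\<close> by raising \<open>s\<close> to \<open>r\<close>, which
  adds a thin shell near the poles, and by tightening the half-spaces of latitude at most
  \<open>1/10\<close>, which removes a thin girdle at the equator inside a spherical shell.

  For \<open>n \<ge> 3\<close> every central hyperplane meets the equatorial hyperplane outside the origin, so
  every section loses an amount comparable to the thickness of the girdle, whereas no section
  gains more than a multiple of \<open>(r - s) / (1 - r\<^sup>2) ^ (n - 1)\<close>. Balancing these two quantities,
  the volume gained, of order \<open>(r - s) / (1 - s\<^sup>2) ^ n\<close>, exceeds the volume lost as soon as \<open>s\<close>
  is close to 1 and \<open>r\<close> is close to \<open>s\<close>.\<close>

section \<open>Hyperbolic convexity through the Klein model\<close>

text \<open>The isometry from the Poincare ball to the Klein ball, in which geodesics are chords.\<close>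

definition klein :: "real^'n \<Rightarrow> real^'n" where
  "klein x = (2 / (1 + (norm x)\<^sup>2)) *\<^sub>R x"

lemma one_minus_norm_sq_pos:
  fixes x :: "'a::real_normed_vector"
  assumes "norm x < 1"
  shows "0 < 1 - (norm x)\<^sup>2"
  using assms by (simp add: abs_square_less_1)

text \<open>The pair \<open>(hyp_time x, hyp_space x)\<close> is the point of the hyperboloid model over \<open>x\<close>.\<close>

definition hyp_time :: "real^'n \<Rightarrow> real" where
  "hyp_time x = (1 + (norm x)\<^sup>2) / (1 - (norm x)\<^sup>2)"

definition hyp_space :: "real^'n \<Rightarrow> real^'n" where
  "hyp_space x = (2 / (1 - (norm x)\<^sup>2)) *\<^sub>R x"

lemma hyp_time_pos: "norm x < 1 \<Longrightarrow> 0 < hyp_time x"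
  using one_minus_norm_sq_pos[of x] by (simp add: hyp_time_def add_pos_nonneg)

lemma hyp_space_eq: "norm x < 1 \<Longrightarrow> hyp_space x = hyp_time x *\<^sub>R klein x"
proof -
  assume "norm x < 1"
  moreover have "1 + (norm x)\<^sup>2 > 0" by (simp add: add_pos_nonneg)
  moreover have "(1 + q) / (1 - q) * (2 / (1 + q)) = 2 / (1 - q)" if "1 + q > 0" for q :: real
  proof -
    have "(1 + q) / (1 - q) * (2 / (1 + q)) = (1 + q) * 2 / ((1 + q) * (1 - q))"
      by (simp only: times_divide_times_eq mult.commute)
    then show ?thesis using that by (simp only: mult_divide_mult_cancel_left_if) simp
  qed
  ultimately show ?thesis
    by (simp only: hyp_space_def klein_def hyp_time_def scaleR_scaleR)
qed

lemma hyp_lorentz_self: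
  assumes "norm x < 1"
  shows "(hyp_time x)\<^sup>2 - hyp_space x \<bullet> hyp_space x = 1"
proof -
  define q where "q = (norm x)\<^sup>2"
  have q: "1 - q \<noteq> 0" using one_minus_norm_sq_pos[OF assms] by (simp add: q_def)
  have "(hyp_time x)\<^sup>2 - hyp_space x \<bullet> hyp_space x = ((1 + q) / (1 - q))\<^sup>2 - (2 / (1 - q))\<^sup>2 * q"
    by (simp add: hyp_time_def hyp_space_def q_def power2_norm_eq_inner power2_eq_square dot_square_norm)
  also have "\<dots> = ((1 + q)\<^sup>2 - 4 * q) / (1 - q)\<^sup>2"
    by (simp add: power_divide diff_divide_distrib)
  also have "(1 + q)\<^sup>2 - 4 * q = (1 - q)\<^sup>2" by (simp add: power2_eq_square algebra_simps)
  finally show ?thesis using q by simp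
qed

text \<open>The argument of \<open>arcosh\<close> in \<open>hdist\<close> is the Lorentz product of
  the two hyperboloid points, so additivity of distances turns into the addition formulas for
  \<open>cosh\<close> and \<open>sinh\<close>.\<close>

lemma cosh_hdist:
  assumes "norm x < 1" "norm y < 1"
  shows "cosh (hdist x y) = hyp_time x * hyp_time y - hyp_space x \<bullet> hyp_space y"
proof -
  define p q where "p = (norm x)\<^sup>2" and "q = (norm y)\<^sup>2"
  have pq: "1 - p > 0" "1 - q > 0"
    using one_minus_norm_sq_pos[OF assms(1)] one_minus_norm_sq_pos[OF assms(2)]
    by (simp_all add: p_def q_def)
  have d: "(norm (x - y))\<^sup>2 = p + q - 2 * (x \<bullet> y)"
    by (simp add: p_def q_def power2_norm_eq_inner inner_diff inner_commute)
  have "cosh (hdist x y) = 1 + 2 * (norm (x - y))\<^sup>2 / ((1 - p) * (1 - q))"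
    unfolding hdist_def p_def[symmetric] q_def[symmetric]
    by (rule cosh_arcosh_real) (use pq in simp)
  also have "\<dots> = ((1 - p) * (1 - q) + 2 * (p + q - 2 * (x \<bullet> y))) / ((1 - p) * (1 - q))"
    using pq unfolding d by (simp add: add_divide_distrib)
  also have "\<dots> = ((1 + p) * (1 + q) - 4 * (x \<bullet> y)) / ((1 - p) * (1 - q))"
    by (simp add: algebra_simps)
  also have "\<dots> = hyp_time x * hyp_time y - hyp_space x \<bullet> hyp_space y"
    by (simp add: hyp_time_def hyp_space_def p_def q_def diff_divide_distrib)
  finally show ?thesis .
qed

lemma hdist_nonneg:
  assumes "norm x < 1" "norm y < 1" shows "0 \<le> hdist x y"
  unfolding hdist_def
  by (rule arcosh_nonneg_real)
     (use one_minus_norm_sq_pos[OF assms(1)] one_minus_norm_sq_pos[OF assms(2)] in simp)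

lemma hdist_eq_0:
  assumes "norm x < 1" "norm y < 1" "hdist x y = 0" shows "x = y"
proof -
  let ?D = "(1 - (norm x)\<^sup>2) * (1 - (norm y)\<^sup>2)"
  have D: "?D > 0"
    using one_minus_norm_sq_pos[OF assms(1)] one_minus_norm_sq_pos[OF assms(2)] by simp
  have "cosh (hdist x y) = 1 + 2 * (norm (x - y))\<^sup>2 / ?D"
    unfolding hdist_def by (rule cosh_arcosh_real) (use D in simp)
  then have "2 * (norm (x - y))\<^sup>2 / ?D = 0" using assms(3) by simp
  then have "(norm (x - y))\<^sup>2 = 0" using D by (metis divide_eq_0_iff less_irrefl mult_eq_0_iff zero_neq_numeral)
  then show ?thesis by simp
qed

text \<open>The Lorentz form is definite on the orthogonal complement of a timelike vector, so a
  null vector there vanishes; Cauchy-Schwarz for the space parts is all that is needed.\<close>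

lemma null_orthogonal_timelike:
  fixes w z :: "'a::real_inner"
  assumes "w0\<^sup>2 = w \<bullet> w" "w0 * z0 = w \<bullet> z" "z \<bullet> z < z0\<^sup>2"
  shows "w0 = 0 \<and> w = 0"
proof -
  have "(w0 * z0)\<^sup>2 \<le> (w \<bullet> w) * (z \<bullet> z)"
    using Cauchy_Schwarz_ineq[of w z] assms(2) by simp
  then have "w0\<^sup>2 * z0\<^sup>2 \<le> w0\<^sup>2 * (z \<bullet> z)" by (simp add: assms(1) power_mult_distrib)
  then have "w0\<^sup>2 = 0" using assms(3)
    by (metis linorder_not_le mult_le_cancel_left zero_le_power2 order_le_less)
  then show ?thesis using assms(1) by simp
qed

text \<open>With \<open>p = hdist x z\<close> and \<open>q = hdist z y\<close>, equality in the triangle inequality makes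
  \<open>sinh q X + sinh p Y - sinh (p + q) Z\<close> Lorentz-orthogonal to all three hyperboloid points
  \<open>X\<close>, \<open>Y\<close>, \<open>Z\<close>, hence null and orthogonal to the timelike \<open>Z\<close>, hence zero.\<close>

lemma hsegment_hyperboloid:
  assumes x: "norm x < 1" and y: "norm y < 1" and z: "z \<in> hsegment x y" and ne: "x \<noteq> y"
  obtains \<alpha> \<beta> where "0 \<le> \<alpha>" "0 \<le> \<beta>"
    "hyp_time z = \<alpha> * hyp_time x + \<beta> * hyp_time y"
    "hyp_space z = \<alpha> *\<^sub>R hyp_space x + \<beta> *\<^sub>R hyp_space y"
proof -
  define p q where "p = hdist x z" and "q = hdist z y"
  have nz: "norm z < 1" and pq: "p + q = hdist x y"
    using z by (auto simp: hsegment_def p_def q_def)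
  have p0: "p \<ge> 0" and q0: "q \<ge> 0"
    using hdist_nonneg x y nz by (auto simp: p_def q_def)
  have pos: "p + q > 0"
    using hdist_eq_0[OF x y] ne p0 q0 unfolding pq[symmetric] by force
  let ?T = hyp_time and ?S = hyp_space
  define W0 where "W0 = sinh q * ?T x + sinh p * ?T y - sinh (p + q) * ?T z"
  define W where "W = sinh q *\<^sub>R ?S x + sinh p *\<^sub>R ?S y - sinh (p + q) *\<^sub>R ?S z"
  have xx: "?S x \<bullet> ?S x = ?T x * ?T x - 1" and yy: "?S y \<bullet> ?S y = ?T y * ?T y - 1"
    and zz: "?S z \<bullet> ?S z = ?T z * ?T z - 1"
    using hyp_lorentz_self[OF x] hyp_lorentz_self[OF y] hyp_lorentz_self[OF nz]
    by (simp_all add: power2_eq_square)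
  have xy: "?S x \<bullet> ?S y = ?T x * ?T y - cosh (p + q)" using cosh_hdist[OF x y] by (simp add: pq)
  have xz: "?S x \<bullet> ?S z = ?T x * ?T z - cosh p" using cosh_hdist[OF x nz] by (simp add: p_def)
  have zy: "?S z \<bullet> ?S y = ?T z * ?T y - cosh q" using cosh_hdist[OF nz y] by (simp add: q_def)
  \<comment> \<open>Expanding \<open>sinh\<close> at p - (p + q) and q - (p + q) gives the two
    identities that cancel the \<open>cosh\<close> terms in the products with the points over
    \<open>x\<close> and \<open>y\<close>.\<close>
  have id1: "sinh p * cosh (p + q) - sinh (p + q) * cosh p = - sinh q"
    using sinh_diff[of p "p + q"] by (simp add: algebra_simps)
  have id2: "sinh q * cosh (p + q) - sinh (p + q) * cosh q = - sinh p"
    using sinh_diff[of q "p + q"] by (simp add: algebra_simps)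
  have Wx: "W \<bullet> ?S x = W0 * ?T x"
  proof -
    have "W \<bullet> ?S x = sinh q * (?S x \<bullet> ?S x) + sinh p * (?S x \<bullet> ?S y) - sinh (p + q) * (?S x \<bullet> ?S z)"
      by (simp add: W_def inner_diff_left inner_add_left inner_commute[of "?S y" "?S x"] inner_commute[of "?S z" "?S x"])
    also have "\<dots> = W0 * ?T x - sinh q - (sinh p * cosh (p + q) - sinh (p + q) * cosh p)"
      unfolding xx xy xz W0_def by (simp add: algebra_simps)
    finally show ?thesis unfolding id1 by simp
  qed
  have Wy: "W \<bullet> ?S y = W0 * ?T y"
  proof -
    have "W \<bullet> ?S y = sinh q * (?S x \<bullet> ?S y) + sinh p * (?S y \<bullet> ?S y) - sinh (p + q) * (?S z \<bullet> ?S y)"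
      by (simp add: W_def inner_diff_left inner_add_left )
    also have "\<dots> = W0 * ?T y - sinh p - (sinh q * cosh (p + q) - sinh (p + q) * cosh q)"
      unfolding yy xy zy W0_def by (simp add: algebra_simps)
    finally show ?thesis unfolding id2 by simp
  qed
  have Wz: "W \<bullet> ?S z = W0 * ?T z"
  proof -
    have "W \<bullet> ?S z = sinh q * (?S x \<bullet> ?S z) + sinh p * (?S z \<bullet> ?S y) - sinh (p + q) * (?S z \<bullet> ?S z)"
      by (simp add: W_def inner_diff_left inner_add_left inner_commute[of "?S y" "?S z"])
    also have "\<dots> = W0 * ?T z"
      unfolding zz xz zy W0_def by (simp add: algebra_simps sinh_add)
    finally show ?thesis .
  qed
  have "W \<bullet> W = sinh q * (W \<bullet> ?S x) + sinh p * (W \<bullet> ?S y) - sinh (p + q) * (W \<bullet> ?S z)"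
    by (subst (2) W_def) (simp add: inner_diff_right inner_add_right)
  also have "\<dots> = W0\<^sup>2"
    unfolding Wx Wy Wz by (simp add: W0_def power2_eq_square algebra_simps)
  finally have "W0 = 0 \<and> W = 0"
    using Wz zz by (intro null_orthogonal_timelike[where z = "?S z" and ?z0.0 = "?T z"])
      (simp_all add: power2_eq_square)
  have s: "sinh (p + q) > 0" using pos by simp
  define c where "c = inverse (sinh (p + q))"
  have c: "c * sinh (p + q) = 1" "c > 0" using s by (simp_all add: c_def)
  have "?T z = c * (sinh (p + q) * ?T z)"
    using c by (simp add: mult.assoc[symmetric])
  also have "\<dots> = c * sinh q * ?T x + c * sinh p * ?T y"
  proof -
    have "sinh (p + q) * ?T z = sinh q * ?T x + sinh p * ?T y"
      using \<open>W0 = 0 \<and> W = 0\<close> by (simp add: W0_def)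
    then show ?thesis by (simp add: algebra_simps)
  qed
  finally have 1: "?T z = c * sinh q * ?T x + c * sinh p * ?T y" .
  have "?S z = c *\<^sub>R (sinh (p + q) *\<^sub>R ?S z)"
    using c by simp
  also have "\<dots> = (c * sinh q) *\<^sub>R ?S x + (c * sinh p) *\<^sub>R ?S y"
    using \<open>W0 = 0 \<and> W = 0\<close> by (simp add: W_def scaleR_add_right[symmetric] flip: scaleR_scaleR)
  finally show ?thesis using that[of "c * sinh q" "c * sinh p"] 1 c p0 q0 by simp
qed

text \<open>The Klein point is the space part divided by the time part. This central projection
  turns nonnegative combinations on the hyperboloid into convex combinations.\<close>

lemma hconvex_klein_vimage:
  assumes C: "convex C"
  shows "hconvex (ball 0 1 \<inter> klein -` C)"
  unfolding hconvex_def
proof (intro ballI subsetI)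
  fix x y z assume "x \<in> ball 0 1 \<inter> klein -` C" "y \<in> ball 0 1 \<inter> klein -` C" and z: "z \<in> hsegment x y"
  then have x: "norm x < 1" "klein x \<in> C" and y: "norm y < 1" "klein y \<in> C" by auto
  have nz: "norm z < 1" using z by (simp add: hsegment_def)
  show "z \<in> ball 0 1 \<inter> klein -` C"
  proof (cases "x = y")
    \<comment> \<open>Here the total length is 0 and the coefficients of
      \<open>hsegment_hyperboloid\<close> would require division by \<open>sinh 0\<close>.\<close>
    case True
    have "hdist x x = 0" by (simp add: hdist_def)
    then have "hdist x z = 0"
      using z True hdist_nonneg[OF x(1) nz] hdist_nonneg[OF nz x(1)] by (simp add: hsegment_def)
    then have "x = z" using hdist_eq_0[OF x(1) nz] by simp
    then show ?thesis using x by simp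
  next
    case False
    obtain \<alpha> \<beta> where ab: "0 \<le> \<alpha>" "0 \<le> \<beta>"
      and t: "hyp_time z = \<alpha> * hyp_time x + \<beta> * hyp_time y"
      and s: "hyp_space z = \<alpha> *\<^sub>R hyp_space x + \<beta> *\<^sub>R hyp_space y"
      using hsegment_hyperboloid[OF x(1) y(1) z False] .
    have tz: "hyp_time z > 0" by (rule hyp_time_pos[OF nz])
    \<comment> \<open>The equation for the time parts says exactly that these weights sum to
      1.\<close>
    define u v where "u = \<alpha> * hyp_time x / hyp_time z" and "v = \<beta> * hyp_time y / hyp_time z"
    have uv: "u \<ge> 0" "v \<ge> 0" "u + v = 1"
      using ab hyp_time_pos[OF x(1)] hyp_time_pos[OF y(1)] tz t
      by (simp_all add: u_def v_def add_divide_distrib[symmetric])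
    have "hyp_time z *\<^sub>R klein z = (\<alpha> * hyp_time x) *\<^sub>R klein x + (\<beta> * hyp_time y) *\<^sub>R klein y"
      using s by (simp add: hyp_space_eq nz x y)
    then have "inverse (hyp_time z) *\<^sub>R hyp_time z *\<^sub>R klein z
       = inverse (hyp_time z) *\<^sub>R ((\<alpha> * hyp_time x) *\<^sub>R klein x + (\<beta> * hyp_time y) *\<^sub>R klein y)"
      by simp
    then have "klein z = u *\<^sub>R klein x + v *\<^sub>R klein y"
      using tz by (simp add: u_def v_def scaleR_add_right divide_inverse_commute)
    then have "klein z \<in> C" using convexD[OF C x(2) y(2) uv] by simp
    then show ?thesis using nz by simp
  qed
qed

section \<open>Barrels and girdles\<close>

text \<open>For positive \<open>a\<close> the half-spaces touch \<open>cball 0 a\<close> at the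
  points of latitude at most \<open>s\<close> with respect to the axis \<open>e\<close>. The set of
  normals is symmetric, so they pair up into slabs; as an intersection of half-spaces the body is
  closed and convex at once.\<close>

definition slab_body :: "real^'n \<Rightarrow> real \<Rightarrow> real \<Rightarrow> (real^'n) set" where
  "slab_body e s a = {x. \<forall>u. norm u = 1 \<and> \<bar>u \<bullet> e\<bar> \<le> s \<longrightarrow> x \<bullet> u \<le> a}"

lemma slab_body_eq:
  "slab_body e s a = (\<Inter>u\<in>{u. norm u = 1 \<and> \<bar>u \<bullet> e\<bar> \<le> s}. {x. u \<bullet> x \<le> a})"
  by (auto simp: slab_body_def inner_commute)

lemma convex_slab_body: "convex (slab_body e s a)"
  unfolding slab_body_eq by (intro convex_INT convex_halfspace_le)

lemma closed_slab_body: "closed (slab_body e s a)"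
  unfolding slab_body_eq by (intro closed_INT ballI closed_halfspace_le)

lemma uminus_slab_body:
  assumes "x \<in> slab_body e s a" shows "- x \<in> slab_body e s a"
  unfolding slab_body_def
proof clarsimp
  fix u assume "norm u = 1" "\<bar>u \<bullet> e\<bar> \<le> s"
  then have "x \<bullet> (- u) \<le> a" using assms unfolding slab_body_def by (auto dest: spec[of _ "-u"])
  then show "- (x \<bullet> u) \<le> a" by simp
qed

text \<open>The direction of \<open>x\<close> is itself an admissible normal. Together with
  \<open>cball_subset_slab_body\<close>, the body coincides with the ball of radius \<open>a\<close>
  at latitudes up to \<open>s\<close>.\<close>

lemma slab_body_norm_le:
  assumes "x \<in> slab_body e s a" "\<bar>x \<bullet> e\<bar> \<le> s * norm x" "0 \<le> a"
  shows "norm x \<le> a"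
proof (cases "x = 0")
  case False
  let ?u = "x /\<^sub>R norm x"
  have "norm ?u = 1" using False by simp
  moreover have "\<bar>?u \<bullet> e\<bar> \<le> s"
    using assms(2) False by (simp add: abs_mult divide_simps mult.commute)
  ultimately have "x \<bullet> ?u \<le> a" using assms(1) unfolding slab_body_def by blast
  moreover have "x \<bullet> ?u = norm x"
    using False by (simp add: dot_square_norm power2_eq_square mult.assoc[symmetric])
  ultimately show ?thesis by simp
qed (use assms in simp)

lemma cball_subset_slab_body:
  fixes e :: "real^'n"
  shows "cball 0 a \<subseteq> slab_body e s a"
proof
  fix x :: "real^'n" assume "x \<in> cball 0 a"
  moreover have "x \<bullet> u \<le> norm x" if "norm u = 1" for u
    using norm_cauchy_schwarz[of x u] that by simp
  ultimately show "x \<in> slab_body e s a" by (force simp: slab_body_def)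
qed

text \<open>Split \<open>x\<close> along the axis. The part of \<open>u\<close> orthogonal to
  \<open>e\<close> is only bounded by 1; the constants chosen later leave room for this
  loss.\<close>

lemma inner_le_axial:
  fixes e x u :: "'a::real_inner"
  assumes e: "norm e = 1" and u: "norm u = 1" and s: "\<bar>u \<bullet> e\<bar> \<le> s"
  shows "x \<bullet> u \<le> norm (x - (x \<bullet> e) *\<^sub>R e) + s * \<bar>x \<bullet> e\<bar>"
proof -
  have "x \<bullet> u = (x - (x \<bullet> e) *\<^sub>R e) \<bullet> u + (x \<bullet> e) * (u \<bullet> e)"
    by (simp add: inner_diff_left inner_commute[of e u])
  moreover have "(x - (x \<bullet> e) *\<^sub>R e) \<bullet> u \<le> norm (x - (x \<bullet> e) *\<^sub>R e)"
    using norm_cauchy_schwarz[of "x - (x \<bullet> e) *\<^sub>R e" u] u by simp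
  moreover have "(x \<bullet> e) * (u \<bullet> e) \<le> \<bar>x \<bullet> e\<bar> * s"
  proof -
    have "(x \<bullet> e) * (u \<bullet> e) \<le> \<bar>x \<bullet> e\<bar> * \<bar>u \<bullet> e\<bar>" by (metis abs_ge_self abs_mult)
    also have "\<dots> \<le> \<bar>x \<bullet> e\<bar> * s" using s by (intro mult_left_mono) auto
    finally show ?thesis .
  qed
  ultimately show ?thesis by (simp add: mult.commute)
qed

lemma slab_body_axial:
  assumes e: "norm e = 1" and "norm (x - (x \<bullet> e) *\<^sub>R e) + s * \<bar>x \<bullet> e\<bar> \<le> a"
  shows "x \<in> slab_body e s a"
  using inner_le_axial[OF e, of _ s x] assms(2) unfolding slab_body_def
  by (blast intro: order_trans)

lemma norm_axial:
  fixes e x :: "'a::real_inner"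
  assumes e: "norm e = 1"
  shows "(norm x)\<^sup>2 = (norm (x - (x \<bullet> e) *\<^sub>R e))\<^sup>2 + (x \<bullet> e)\<^sup>2"
proof -
  have "e \<bullet> e = 1" using e by (simp add: dot_square_norm)
  then show ?thesis
    unfolding power2_norm_eq_inner
    by (simp add: inner_diff_left inner_diff_right inner_commute power2_eq_square)
qed

text \<open>Sine 3/5 goes with cosine 4/5, so the bounding cones have rational slopes. Off the axis
  the meridian of \<open>x\<close> is determined and the extreme normal in it can be tested.\<close>

lemma slab_body_meridian:
  assumes e: "norm e = 1" and x: "x \<in> slab_body e (3/5) a"
    and p: "x - (x \<bullet> e) *\<^sub>R e \<noteq> 0"
  shows "4/5 * norm (x - (x \<bullet> e) *\<^sub>R e) + 3/5 * \<bar>x \<bullet> e\<bar> \<le> a"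
proof -
  define v where "v = x - (x \<bullet> e) *\<^sub>R e"
  \<comment> \<open>the normal at latitude \<open>3/5\<close> in the meridian half-plane of \<open>x\<close>\<close>
  define \<sigma> :: real where "\<sigma> = (if x \<bullet> e \<ge> 0 then 1 else -1)"
  define u where "u = (4/5 / norm v) *\<^sub>R v + (3/5 * \<sigma>) *\<^sub>R e"
  have ee: "e \<bullet> e = 1" using e by (simp add: dot_square_norm)
  have ve: "v \<bullet> e = 0" by (simp add: v_def inner_diff_left ee)
  have nv: "norm v > 0" using p by (simp add: v_def)
  have ss: "\<sigma> * \<sigma> = 1" by (simp add: \<sigma>_def)
  have ue: "u \<bullet> e = 3/5 * \<sigma>" by (simp add: u_def inner_add_left ve ee)
  have uv: "u \<bullet> v = 4/5 * norm v" using nv ve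
    by (simp add: u_def inner_add_left inner_commute[of e] dot_square_norm power2_eq_square)
  have "u \<bullet> u = (4/5 / norm v) * (u \<bullet> v) + (3/5 * \<sigma>) * (u \<bullet> e)"
    by (subst (2) u_def) (simp add: inner_add_right)
  also have "\<dots> = 16/25 + 9/25 * (\<sigma> * \<sigma>)" using nv unfolding uv ue by simp
  finally have "norm u = 1" by (simp add: norm_eq_sqrt_inner ss)
  moreover have "\<bar>u \<bullet> e\<bar> \<le> 3/5" unfolding ue by (simp add: \<sigma>_def)
  ultimately have "x \<bullet> u \<le> a" using x by (simp add: slab_body_def)
  moreover have "x = v + (x \<bullet> e) *\<^sub>R e" by (simp add: v_def)
  then have "x \<bullet> u = u \<bullet> v + (x \<bullet> e) * (u \<bullet> e)"
    by (metis inner_add_right inner_commute inner_scaleR_right)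
  moreover have "(x \<bullet> e) * \<sigma> = \<bar>x \<bullet> e\<bar>" by (simp add: \<sigma>_def)
  ultimately show ?thesis unfolding uv ue by (simp add: v_def algebra_simps)
qed

text \<open>Past the tangent latitude \<open>3/5\<close> the larger slab body already lies strictly inside
  all slabs of latitude at most \<open>1/10\<close>, so that cutting by these slabs removes nothing
  outside the ball of radius \<open>4/5\<close>.\<close>

lemma slab_body_polar:
  assumes e: "norm e = 1" and x: "x \<in> slab_body e (3/5) (4/5)" "norm x \<le> 1"
    and polar: "\<not> \<bar>x \<bullet> e\<bar> \<le> 3/5 * norm x" and a: "7/10 \<le> a"
  shows "x \<in> slab_body e (1/10) a"
proof (rule slab_body_axial[OF e])
  define p y where "p = norm (x - (x \<bullet> e) *\<^sub>R e)" and "y = \<bar>x \<bullet> e\<bar>"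
  have n: "(norm x)\<^sup>2 = p\<^sup>2 + y\<^sup>2" using norm_axial[OF e, of x] by (simp add: p_def y_def)
  have p0: "p \<ge> 0" "y \<ge> 0" by (simp_all add: p_def y_def)
  have "y \<le> norm x" using Cauchy_Schwarz_ineq2[of x e] e by (simp add: y_def)
  then have y1: "y \<le> 1" using x by simp
  show "p + 1/10 * y \<le> a"
  proof (cases "p = 0")
    case True then show ?thesis using y1 a by simp
  next
    case False
    have "4/5 * p + 3/5 * y \<le> 4/5"
      using slab_body_meridian[OF e x(1)] False unfolding p_def y_def by simp
    moreover have "3/4 * p \<le> y"
    proof (rule ccontr)
      assume "\<not> ?thesis"
      then have "y\<^sup>2 \<le> (3/4 * p)\<^sup>2" using p0 by (intro power_mono) auto
      then have "25/9 * y\<^sup>2 \<le> (norm x)\<^sup>2" unfolding n by (simp add: power_mult_distrib power_divide)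
      then have "(5/3 * y)\<^sup>2 \<le> (norm x)\<^sup>2" by (simp add: power_mult_distrib power_divide)
      then have "5/3 * y \<le> norm x" by (rule power2_le_imp_le) simp
      then show False using polar by (simp add: y_def)
    qed
    \<comment> \<open>Under both constraints p + y/10 is largest at p = 16/25, y = 12/25, the
      tangent point of latitude 3/5. The value there is 86/125, which explains the threshold
      7/10.\<close>
    ultimately show ?thesis using a p0 by linarith
  qed
qed

section \<open>The Klein map on radii and directions, and the bodies in Poincare coordinates\<close>

definition klein_radius :: "real \<Rightarrow> real" where
  "klein_radius r = 2 * r / (1 + r\<^sup>2)"

lemma klein_scale: "klein x = (2 / (1 + (norm x)\<^sup>2)) *\<^sub>R x" "0 < 2 / (1 + (norm x)\<^sup>2)"
  by (simp_all add: klein_def add_pos_nonneg)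

lemma norm_klein: "norm (klein x) = klein_radius (norm x)"
  by (simp add: klein_def klein_radius_def add_nonneg_nonneg)

lemma norm_klein_le_1: "norm (klein x) \<le> 1"
proof -
  have "0 \<le> (1 - norm x)\<^sup>2" by simp
  then have "2 * norm x \<le> 1 + (norm x)\<^sup>2" unfolding power2_diff by simp
  moreover have "1 + (norm x)\<^sup>2 > 0" by (simp add: add_pos_nonneg)
  ultimately show ?thesis unfolding norm_klein klein_radius_def by simp
qed

lemma klein_minus: "klein (- x) = - klein x"
  by (simp add: klein_def)

lemma continuous_on_klein: "continuous_on S klein"
proof -
  have "1 + (norm x)\<^sup>2 \<noteq> 0" for x :: "real^'n" using zero_le_power2[of "norm x"] by linarith
  then show ?thesis unfolding klein_def by (intro continuous_intros) auto
qed

text \<open>After clearing denominators the difference factors as 2 (r - x) (1 - x r), with second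
  factor positive.\<close>

lemma klein_radius_le_iff:
  assumes "0 \<le> x" "x < 1" "0 \<le> r" "r < 1"
  shows "klein_radius x \<le> klein_radius r \<longleftrightarrow> x \<le> r"
proof -
  have pos: "1 + x\<^sup>2 > 0" "1 + r\<^sup>2 > 0" by (simp_all add: add_pos_nonneg)
  have "x * r < 1 * 1" by (rule mult_strict_mono) (use assms in auto)
  then have xr: "1 - x * r > 0" by simp
  have "klein_radius x \<le> klein_radius r \<longleftrightarrow> 2 * x * (1 + r\<^sup>2) \<le> 2 * r * (1 + x\<^sup>2)"
    unfolding klein_radius_def using pos by (simp add: divide_simps)
  also have "\<dots> \<longleftrightarrow> 0 \<le> 2 * ((r - x) * (1 - x * r))" by (simp add: algebra_simps power2_eq_square)
  also have "\<dots> \<longleftrightarrow> 0 \<le> (r - x) * (1 - x * r)" by simp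
  also have "\<dots> \<longleftrightarrow> x \<le> r" using xr by (simp add: zero_le_mult_iff)
  finally show ?thesis .
qed

text \<open>Radii are Poincare radii; the waist of \<open>barrel\<close> has Poincare radius \<open>1/2\<close>, which is the
  Klein radius \<open>4/5\<close>.\<close>

definition barrel :: "real^'n \<Rightarrow> real \<Rightarrow> (real^'n) set" where
  "barrel e r = cball 0 r \<inter> klein -` slab_body e (3/5) (4/5)"

definition girdled_barrel :: "real^'n \<Rightarrow> real \<Rightarrow> real \<Rightarrow> (real^'n) set" where
  "girdled_barrel e r t = barrel e r \<inter> klein -` slab_body e (1/10) (klein_radius t)"

text \<open>A test region on which the added shell is certainly present. The aperture 1/5 is the
  largest allowed by \<open>polar_cone_subset\<close> for the latitude 3/5 and the Klein waist
  4/5.\<close>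

definition polar_cone :: "real^'n \<Rightarrow> (real^'n) set" where
  "polar_cone e = {x. norm (x - (x \<bullet> e) *\<^sub>R e) \<le> norm x / 5}"

text \<open>A test region for the removed girdle; 1/10 is the latitude up to which the slabs of
  \<open>girdled_barrel\<close> are tightened.\<close>

definition equatorial_cone :: "real^'n \<Rightarrow> (real^'n) set" where
  "equatorial_cone e = {x. \<bar>x \<bullet> e\<bar> \<le> norm x / 10}"

lemma klein_radius_half: "klein_radius (1/2) = 4/5"
  by (simp add: klein_radius_def power2_eq_square)

text \<open>Translates the threshold 7/10 of \<open>slab_body_polar\<close> into a Poincare radius;
  9/20 has Klein radius about 0.748.\<close>

lemma klein_radius_waist:
  assumes "9/20 \<le> t" "t < 1" shows "7/10 \<le> klein_radius t"
proof -
  have "klein_radius (9/20) \<le> klein_radius t" using assms by (subst klein_radius_le_iff) auto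
  moreover have "7/10 \<le> klein_radius (9/20)" by (simp add: klein_radius_def power2_eq_square)
  ultimately show ?thesis by simp
qed

lemma klein_latitude: "\<bar>klein x \<bullet> e\<bar> \<le> s * norm (klein x) \<longleftrightarrow> \<bar>x \<bullet> e\<bar> \<le> s * norm x"
proof -
  obtain c where c: "klein x = c *\<^sub>R x" "c > 0" using klein_scale by metis
  have "\<bar>klein x \<bullet> e\<bar> \<le> s * norm (klein x) \<longleftrightarrow> c * \<bar>x \<bullet> e\<bar> \<le> c * (s * norm x)"
    using c by (simp add: abs_mult mult_ac)
  then show ?thesis using c by simp
qed

text \<open>The Klein map keeps directions and has norm at most 1, so on the cone the transverse
  part is at most 1/5 and the axial part at most 1. The bound does not depend on the radius: the
  slabs leave the cone untouched up to the ideal boundary.\<close>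

lemma polar_cone_subset:
  assumes e: "norm e = 1" and x: "x \<in> polar_cone e" "norm x < 1" and "0 \<le> s" "1/5 + s \<le> a"
  shows "klein x \<in> slab_body e s a"
proof (rule slab_body_axial[OF e])
  note n = norm_klein_le_1[of x]
  obtain c where c: "klein x = c *\<^sub>R x" "c > 0" using klein_scale by metis
  have "norm (klein x - (klein x \<bullet> e) *\<^sub>R e) = c * norm (x - (x \<bullet> e) *\<^sub>R e)"
    using c by (metis (no_types) abs_of_pos inner_scaleR_left norm_scaleR scaleR_diff_right scaleR_scaleR)
  also have "\<dots> \<le> c * (norm x / 5)" using x c by (simp add: polar_cone_def)
  also have "\<dots> = norm (klein x) / 5" using c by simp
  finally have 1: "norm (klein x - (klein x \<bullet> e) *\<^sub>R e) \<le> 1/5" using n by simp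
  have "\<bar>klein x \<bullet> e\<bar> \<le> 1" using Cauchy_Schwarz_ineq2[of "klein x" e] e n by simp
  then have "s * \<bar>klein x \<bullet> e\<bar> \<le> s" using assms by (simp add: mult_left_le)
  then show "norm (klein x - (klein x \<bullet> e) *\<^sub>R e) + s * \<bar>klein x \<bullet> e\<bar> \<le> a"
    using 1 assms by linarith
qed

section \<open>Integrals and measures of cylinders\<close>

lemma integral_le_const_measure:
  fixes f :: "'a::euclidean_space \<Rightarrow> real"
  assumes f: "f integrable_on S" and T: "T \<in> lmeasurable" and "S \<subseteq> T" "0 \<le> c"
    and le: "\<And>x. x \<in> S \<Longrightarrow> f x \<le> c"
  shows "integral S f \<le> c * measure lebesgue T"
proof -
  have "integral UNIV (\<lambda>x. if x \<in> S then f x else 0) \<le> integral UNIV (\<lambda>x. c * indicator T x)"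
  proof (rule integral_le)
    show "(\<lambda>x. if x \<in> S then f x else 0) integrable_on UNIV"
      using f by (simp add: integrable_restrict_UNIV)
    show "(\<lambda>x. c * indicator T x) integrable_on UNIV"
      using T by (intro integrable_on_mult_right) (simp add: integrable_on_indicator)
  qed (use assms in \<open>auto simp: indicator_def\<close>)
  then show ?thesis
    using T by (simp add: integral_restrict_UNIV lmeasure_integral_UNIV)
qed

lemma integral_ge_const_measure:
  fixes f :: "'a::euclidean_space \<Rightarrow> real"
  assumes f: "f integrable_on S" and T: "T \<in> lmeasurable" and "T \<subseteq> S"
    and ge: "\<And>x. x \<in> T \<Longrightarrow> c \<le> f x" and nn: "\<And>x. x \<in> S \<Longrightarrow> 0 \<le> f x"
  shows "c * measure lebesgue T \<le> integral S f"
proof -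
  have "integral UNIV (\<lambda>x. c * indicator T x) \<le> integral UNIV (\<lambda>x. if x \<in> S then f x else 0)"
  proof (rule integral_le)
    show "(\<lambda>x. if x \<in> S then f x else 0) integrable_on UNIV"
      using f by (simp add: integrable_restrict_UNIV)
    show "(\<lambda>x. c * indicator T x) integrable_on UNIV"
      using T by (intro integrable_on_mult_right) (simp add: integrable_on_indicator)
  qed (use assms in \<open>auto simp: indicator_def\<close>)
  then show ?thesis
    using T by (simp add: integral_restrict_UNIV lmeasure_integral_UNIV)
qed

text \<open>The integral over the common part cancels, so only an outer bound \<open>U\<close> for
  one difference and an inner bound \<open>T\<close> for the other matter. For volumes
  \<open>A\<close> is the barrel, for sections it is the cylinder over the girdled barrel.\<close>

lemma integral_compare:
  fixes f :: "'a::euclidean_space \<Rightarrow> real"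
  assumes A: "f integrable_on A" and B: "f integrable_on B" and AB: "f integrable_on (A \<inter> B)"
    and nn: "\<And>x. x \<in> A \<union> B \<Longrightarrow> 0 \<le> f x"
    and U: "U \<in> lmeasurable" "A - B \<subseteq> U" "0 \<le> b" "\<And>x. x \<in> A - B \<Longrightarrow> f x \<le> b"
    and T: "T \<in> lmeasurable" "T \<subseteq> B - A" "\<And>x. x \<in> T \<Longrightarrow> a \<le> f x"
  shows "integral A f - b * measure lebesgue U \<le> integral B f - a * measure lebesgue T"
proof -
  have i: "((f has_integral integral A f - integral (A \<inter> B) f) (A - A \<inter> B))"
    "((f has_integral integral B f - integral (A \<inter> B) f) (B - A \<inter> B))"
    using A B AB by (auto intro!: has_integral_setdiff)
  have s: "A - A \<inter> B = A - B" "B - A \<inter> B = B - A" by auto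
  have "integral A f - integral (A \<inter> B) f = integral (A - B) f"
    and "integral B f - integral (A \<inter> B) f = integral (B - A) f"
    using i unfolding s by (auto simp: has_integral_iff)
  moreover have "integral (A - B) f \<le> b * measure lebesgue U"
    using i(1) U unfolding s by (intro integral_le_const_measure) (auto simp: has_integral_iff)
  moreover have "a * measure lebesgue T \<le> integral (B - A) f"
    using i(2) T nn unfolding s by (intro integral_ge_const_measure) (auto simp: has_integral_iff)
  ultimately show ?thesis by linarith
qed

lemma compact_integral_compare:
  fixes f :: "'a::euclidean_space \<Rightarrow> real"
  assumes A: "compact A" and B: "compact B" and f: "continuous_on (A \<union> B) f"
    and nn: "\<And>x. x \<in> A \<union> B \<Longrightarrow> 0 \<le> f x"
    and U: "U \<in> lmeasurable" "A - B \<subseteq> U" "0 \<le> b" "\<And>x. x \<in> A - B \<Longrightarrow> f x \<le> b"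
    and T: "T \<in> lmeasurable" "T \<subseteq> B - A" "\<And>x. x \<in> T \<Longrightarrow> a \<le> f x"
  shows "integral A f - b * measure lebesgue U \<le> integral B f - a * measure lebesgue T"
proof (rule integral_compare[OF _ _ _ nn U T])
  have int: "f integrable_on S" if "compact S" "S \<subseteq> A \<union> B" for S
  proof -
    have "set_integrable lborel S f"
      unfolding set_integrable_def
      by (rule borel_integrable_compact[OF that(1) continuous_on_subset[OF f that(2)]])
    then show ?thesis by (rule set_borel_integral_eq_integral(1))
  qed
  show "f integrable_on A" "f integrable_on B" "f integrable_on A \<inter> B"
    using A B by (auto intro!: int compact_Int)
qed auto

section \<open>Cylinders over sections, the domains of integration in
  \<open>hsection_vol\<close>\<close>

definition hcyl :: "real^'n \<Rightarrow> (real^'n) set \<Rightarrow> (real^'n) set" where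
  "hcyl xi A = {x. 0 \<le> x \<bullet> xi \<and> x \<bullet> xi \<le> 1 \<and> x - (x \<bullet> xi) *\<^sub>R xi \<in> A}"

lemma closed_hcyl:
  assumes "closed A" shows "closed (hcyl xi A)"
proof -
  have "hcyl xi A = {x. 0 \<le> x \<bullet> xi} \<inter> {x. x \<bullet> xi \<le> 1} \<inter> (\<lambda>x. x - (x \<bullet> xi) *\<^sub>R xi) -` A"
    by (auto simp: hcyl_def)
  moreover have "closed ((\<lambda>x. x - (x \<bullet> xi) *\<^sub>R xi) -` A)"
    by (intro closed_vimage assms continuous_intros)
  ultimately show ?thesis by (auto intro!: closed_Int closed_Collect_le continuous_intros)
qed

lemma hcyl_cball_subset:
  assumes "norm xi = 1" "A \<subseteq> cball 0 r" shows "hcyl xi A \<subseteq> cball 0 (r + 1)"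
proof
  fix x assume x: "x \<in> hcyl xi A"
  then have "norm (x - (x \<bullet> xi) *\<^sub>R xi) \<le> r" "\<bar>x \<bullet> xi\<bar> \<le> 1"
    using assms by (auto simp: hcyl_def subset_eq)
  moreover have "norm x \<le> norm (x - (x \<bullet> xi) *\<^sub>R xi) + norm ((x \<bullet> xi) *\<^sub>R xi)"
    by (metis add.commute diff_add_cancel norm_triangle_ineq)
  ultimately show "x \<in> cball 0 (r + 1)" using assms by simp
qed

lemma compact_hcyl:
  assumes "norm xi = 1" "compact A" shows "compact (hcyl xi A)"
proof -
  obtain r where "A \<subseteq> cball 0 r"
    using bounded_subset_ballD[OF compact_imp_bounded[OF assms(2)], of 0] ball_subset_cball
    by (meson order_trans)
  then have "bounded (hcyl xi A)"
    using hcyl_cball_subset[OF assms(1)] bounded_cball bounded_subset by metis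
  then show ?thesis
    using closed_hcyl[of A xi] assms compact_imp_closed by (auto simp: compact_eq_bounded_closed)
qed

lemma hcyl_Diff: "hcyl xi (A - B) = hcyl xi A - hcyl xi B"
  and hcyl_mono: "A \<subseteq> B \<Longrightarrow> hcyl xi A \<subseteq> hcyl xi B"
  by (auto simp: hcyl_def)

text \<open>Cauchy's functional equation: enclosing n h between consecutive integers bounds n times
  the deviation from linearity by f 1, for every n.\<close>

lemma monotone_additive_linear:
  fixes f :: "real \<Rightarrow> real"
  assumes mono: "\<And>a b. 0 \<le> a \<Longrightarrow> a \<le> b \<Longrightarrow> f a \<le> f b"
    and add: "\<And>a b. 0 \<le> a \<Longrightarrow> 0 \<le> b \<Longrightarrow> f (a + b) = f a + f b"
    and h: "0 \<le> h"
  shows "f h = h * f 1"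
proof -
  have f0: "f 0 = 0" using add[of 0 0] by simp
  have f1: "f 1 \<ge> 0" using mono[of 0 1] f0 by simp
  have mult: "f (real n * x) = real n * f x" if "0 \<le> x" for n x
  proof (induction n)
    case (Suc n)
    have "f (real (Suc n) * x) = f (real n * x + x)" by (simp add: algebra_simps)
    also have "\<dots> = f (real n * x) + f x" using that by (intro add) auto
    finally show ?case using Suc by (simp add: algebra_simps)
  qed (simp add: f0)
  have int: "f (real n) = real n * f 1" for n using mult[of 1 n] by simp
  have bound: "real n * \<bar>f h - h * f 1\<bar> \<le> f 1" for n
  proof -
    define m where "m = nat \<lfloor>real n * h\<rfloor>"
    have m: "real m \<le> real n * h" "real n * h \<le> real (Suc m)"
      using h by (simp_all add: m_def) (linarith)+
    have "real m * f 1 \<le> real n * f h"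
      using mono[OF _ m(1)] by (simp add: int mult h)
    moreover have "real n * f h \<le> real (Suc m) * f 1"
      using mono[OF _ m(2)] h by (simp only: int mult[OF h]) simp
    moreover have "real m * f 1 \<le> real n * h * f 1" "real n * h * f 1 \<le> real (Suc m) * f 1"
      using m f1 by (intro mult_right_mono; simp)+
    ultimately have "\<bar>real n * f h - real n * h * f 1\<bar> \<le> f 1"
      by (simp add: algebra_simps abs_le_iff)
    moreover have "real n * f h - real n * h * f 1 = real n * (f h - h * f 1)"
      by (simp add: algebra_simps)
    ultimately show ?thesis by (simp add: abs_mult)
  qed
  have "\<bar>f h - h * f 1\<bar> = 0"
  proof (rule ccontr)
    assume "\<not> ?thesis"
    then have "\<bar>f h - h * f 1\<bar> > 0" by linarith
    then obtain n where "f 1 < real n * \<bar>f h - h * f 1\<bar>" using reals_Archimedean3 by blast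
    then show False using bound[of n] by linarith
  qed
  then show ?thesis by simp
qed

lemma measure_scaleR_image:
  fixes S :: "(real^'n) set"
  assumes "S \<in> lmeasurable" "0 \<le> r"
  shows "measure lebesgue ((*\<^sub>R) r ` S) = r ^ CARD('n) * measure lebesgue S"
proof -
  have "(*\<^sub>R) r = (\<lambda>x::real^'n. \<chi> k. r * x $ k)" by (simp add: fun_eq_iff vec_eq_iff)
  then show ?thesis using measure_stretch[OF assms(1), of "\<lambda>_. r"] assms(2) by simp
qed

text \<open>Half-open in height, so that stacked cylinders are disjoint; for heights 0 to 1 it
  differs from \<open>hcyl\<close> only by the top face, which lies in a hyperplane.\<close>

definition strip_cyl :: "real^'n \<Rightarrow> real \<Rightarrow> real \<Rightarrow> (real^'n) set \<Rightarrow> (real^'n) set" where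
  "strip_cyl xi a b A = {x. a \<le> x \<bullet> xi \<and> x \<bullet> xi < b \<and> x - (x \<bullet> xi) *\<^sub>R xi \<in> A}"

lemma strip_cyl_lmeasurable:
  assumes xi: "norm xi = 1" and A: "compact A"
  shows "strip_cyl xi a b A \<in> lmeasurable"
proof (rule bounded_set_imp_lmeasurable)
  obtain r where r: "A \<subseteq> ball 0 r"
    using bounded_subset_ballD[OF compact_imp_bounded[OF A]] by blast
  have "norm x \<le> r + (\<bar>a\<bar> + \<bar>b\<bar>)" if "x \<in> strip_cyl xi a b A" for x
  proof -
    have "norm (x - (x \<bullet> xi) *\<^sub>R xi) \<le> r" "\<bar>x \<bullet> xi\<bar> \<le> \<bar>a\<bar> + \<bar>b\<bar>"
      using that r by (auto simp: strip_cyl_def subset_eq less_imp_le)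
    moreover have "norm x \<le> norm (x - (x \<bullet> xi) *\<^sub>R xi) + norm ((x \<bullet> xi) *\<^sub>R xi)"
      by (metis add.commute diff_add_cancel norm_triangle_ineq)
    ultimately show ?thesis using xi by simp
  qed
  then show "bounded (strip_cyl xi a b A)" by (auto simp: bounded_iff)
  have "strip_cyl xi a b A = {x. a \<le> x \<bullet> xi} \<inter> {x. x \<bullet> xi < b} \<inter> (\<lambda>x. x - (x \<bullet> xi) *\<^sub>R xi) -` A"
    by (auto simp: strip_cyl_def)
  moreover have "closed ((\<lambda>x. x - (x \<bullet> xi) *\<^sub>R xi) -` A)"
    by (intro closed_vimage compact_imp_closed[OF A] continuous_intros)
  moreover have "closed {x. a \<le> x \<bullet> xi}" "open {x. x \<bullet> xi < b}"
    by (auto intro!: closed_Collect_le open_Collect_less continuous_intros)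
  ultimately show "strip_cyl xi a b A \<in> sets lebesgue"
    by (auto intro!: sets.Int)
qed

text \<open>The measure is monotone in the height, and additive by translation along
  \<open>xi\<close>. Linearity follows without applying Fubini in a rotated frame.\<close>

lemma measure_strip_cyl_height:
  assumes xi: "norm xi = 1" and A: "compact A" and h: "0 \<le> h"
  shows "measure lebesgue (strip_cyl xi 0 h A) = h * measure lebesgue (strip_cyl xi 0 1 A)"
proof (rule monotone_additive_linear[OF _ _ h])
  note lm = strip_cyl_lmeasurable[OF xi A]
  show "measure lebesgue (strip_cyl xi 0 a A) \<le> measure lebesgue (strip_cyl xi 0 b A)" if "a \<le> b" for a b
    using that by (intro measure_mono_fmeasurable lm fmeasurableD) (auto simp: strip_cyl_def)
  fix a b :: real assume ab: "0 \<le> a" "0 \<le> b"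
  have xx: "xi \<bullet> xi = 1" using xi by (simp add: dot_square_norm)
  have "strip_cyl xi a (a + b) A = (+) (a *\<^sub>R xi) ` strip_cyl xi 0 b A"
  proof -
    have mem: "a *\<^sub>R xi + x \<in> strip_cyl xi a (a + b) A \<longleftrightarrow> x \<in> strip_cyl xi 0 b A" for x
      by (simp add: strip_cyl_def inner_add_left xx scaleR_add_left)
    have "x \<in> (+) (a *\<^sub>R xi) ` strip_cyl xi 0 b A" if "x \<in> strip_cyl xi a (a + b) A" for x
    proof
      show "x = a *\<^sub>R xi + (x - a *\<^sub>R xi)" by simp
      then show "x - a *\<^sub>R xi \<in> strip_cyl xi 0 b A" using that mem by metis
    qed
    then show ?thesis using mem by auto
  qed
  then have tr: "measure lebesgue (strip_cyl xi a (a + b) A) = measure lebesgue (strip_cyl xi 0 b A)"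
    by (simp add: measure_translation)
  have "strip_cyl xi 0 (a + b) A = strip_cyl xi 0 a A \<union> strip_cyl xi a (a + b) A"
    and "strip_cyl xi 0 a A \<inter> strip_cyl xi a (a + b) A = {}"
    using ab by (auto simp: strip_cyl_def)
  then show "measure lebesgue (strip_cyl xi 0 (a + b) A)
      = measure lebesgue (strip_cyl xi 0 a A) + measure lebesgue (strip_cyl xi 0 b A)"
    using measure_Un3[OF lm[of 0 a] lm[of a "a + b"]] tr by simp
qed

lemma measure_hcyl_eq_strip_cyl:
  assumes xi: "norm xi = 1" and A: "compact A"
  shows "measure lebesgue (hcyl xi A) = measure lebesgue (strip_cyl xi 0 1 A)"
proof (rule measure_negligible_symdiff)
  show "negligible (sym_diff (strip_cyl xi 0 1 A) (hcyl xi A))"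
  proof (rule negligible_subset)
    show "negligible {x. xi \<bullet> x = 1}" using xi by (intro negligible_hyperplane) auto
  qed (auto simp: strip_cyl_def hcyl_def inner_commute)
qed (rule strip_cyl_lmeasurable[OF xi A])

text \<open>Scaling the whole space by \<open>r\<close> also scales the height of the cylinder, which accounts
  for one of the \<open>n\<close> factors.\<close>

lemma measure_hcyl_scale:
  fixes xi :: "real^'n"
  assumes xi: "norm xi = 1" and A: "compact A" and r: "0 < r"
  shows "measure lebesgue (hcyl xi ((*\<^sub>R) r ` A)) = r ^ (CARD('n) - 1) * measure lebesgue (hcyl xi A)"
proof -
  have rA: "compact ((*\<^sub>R) r ` A)" using A by (simp add: compact_scaling)
  have "strip_cyl xi 0 r ((*\<^sub>R) r ` A) = (*\<^sub>R) r ` strip_cyl xi 0 1 A"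
  proof -
    have inj: "inj ((*\<^sub>R) r :: real^'n \<Rightarrow> _)" using r by (simp add: inj_def)
    have pr: "r *\<^sub>R x - (r *\<^sub>R x \<bullet> xi) *\<^sub>R xi = r *\<^sub>R (x - (x \<bullet> xi) *\<^sub>R xi)" for x
      by (simp add: scaleR_diff_right)
    have mem: "r *\<^sub>R x \<in> strip_cyl xi 0 r ((*\<^sub>R) r ` A) \<longleftrightarrow> x \<in> strip_cyl xi 0 1 A" for x
      unfolding strip_cyl_def mem_Collect_eq pr inj_image_mem_iff[OF inj]
      using r by (simp add: zero_le_mult_iff)
    have "x = r *\<^sub>R (inverse r *\<^sub>R x)" for x :: "real^'n" using r by simp
    then show ?thesis using mem by (metis (no_types, lifting) image_iff subsetI subset_antisym)
  qed
  then have "r * measure lebesgue (hcyl xi ((*\<^sub>R) r ` A)) = r ^ CARD('n) * measure lebesgue (hcyl xi A)"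
    using measure_strip_cyl_height[OF xi rA, of r] measure_scaleR_image[OF strip_cyl_lmeasurable[OF xi A], of r 0 1] r
    by (simp add: measure_hcyl_eq_strip_cyl xi A rA)
  also have "\<dots> = r * (r ^ (CARD('n) - 1) * measure lebesgue (hcyl xi A))"
    using power_minus_mult[of "CARD('n)" r] by (simp add: mult_ac)
  finally show ?thesis using r by simp
qed

section \<open>Homogeneity of cones cut by balls and annuli\<close>

lemma cone_Int_cball_scale:
  fixes C :: "'a::real_normed_vector set"
  assumes C: "\<And>c x. 0 < c \<Longrightarrow> c *\<^sub>R x \<in> C \<longleftrightarrow> x \<in> C" and r: "0 < r"
  shows "C \<inter> cball 0 r = (*\<^sub>R) r ` (C \<inter> cball 0 1)"
proof -
  have "x \<in> (*\<^sub>R) r ` (C \<inter> cball 0 1)" if "x \<in> C" "norm x \<le> r" for x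
  proof
    show "x = r *\<^sub>R (inverse r *\<^sub>R x)" using r by simp
    show "inverse r *\<^sub>R x \<in> C \<inter> cball 0 1"
      using that C[of "inverse r" x] r by (simp add: divide_simps)
  qed
  moreover have "r * norm x \<le> r" if "norm x \<le> 1" for x :: 'a
    using that r by simp
  ultimately show ?thesis using C r by auto
qed

text \<open>Half-open, so that it is exactly a difference of two concentric closed balls.\<close>

definition annulus :: "real \<Rightarrow> real \<Rightarrow> 'a::real_normed_vector set" where
  "annulus s r = {x. s < norm x \<and> norm x \<le> r}"

lemma measure_cone_annulus:
  fixes C :: "(real^'n) set"
  assumes C: "\<And>c x. 0 < c \<Longrightarrow> c *\<^sub>R x \<in> C \<longleftrightarrow> x \<in> C" and cl: "closed C" and sr: "0 < s" "s \<le> r"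
  shows "C \<inter> annulus s r \<in> lmeasurable"
    and "measure lebesgue (C \<inter> annulus s r) = (r ^ CARD('n) - s ^ CARD('n)) * measure lebesgue (C \<inter> cball 0 1)"
proof -
  have comp: "compact (C \<inter> cball 0 t)" for t
    using cl by (simp add: closed_Int_compact)
  have eq: "C \<inter> annulus s r = C \<inter> cball 0 r - C \<inter> cball 0 s" by (auto simp: annulus_def)
  have sub: "C \<inter> cball 0 s \<subseteq> C \<inter> cball 0 r" using sr by auto
  have m: "measure lebesgue (C \<inter> cball 0 t) = t ^ CARD('n) * measure lebesgue (C \<inter> cball 0 1)" if "t > 0" for t
  proof -
    show ?thesis
      using cone_Int_cball_scale[OF C that] measure_scaleR_image[OF lmeasurable_compact[OF comp]] that
      by simp
  qed
  show "C \<inter> annulus s r \<in> lmeasurable"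
    unfolding eq using comp by (simp add: fmeasurable.Diff lmeasurable_compact)
  have "measure lebesgue (C \<inter> annulus s r)
      = measure lebesgue (C \<inter> cball 0 r) - measure lebesgue (C \<inter> cball 0 s)"
    unfolding eq using comp sub by (intro measurable_measure_Diff) (auto simp: lmeasurable_compact fmeasurableD)
  then show "measure lebesgue (C \<inter> annulus s r) = (r ^ CARD('n) - s ^ CARD('n)) * measure lebesgue (C \<inter> cball 0 1)"
    using m[of r] m[of s] sr by (simp add: algebra_simps)
qed

text \<open>As in \<open>measure_cone_annulus\<close>, but the section scales with the dimension n -
  1 of the hyperplane.\<close>

lemma measure_hcyl_cone_annulus:
  fixes C :: "(real^'n) set"
  assumes C: "\<And>c x. 0 < c \<Longrightarrow> c *\<^sub>R x \<in> C \<longleftrightarrow> x \<in> C" and cl: "closed C" and sr: "0 < s" "s \<le> r"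
    and xi: "norm xi = 1"
  shows "hcyl xi (C \<inter> annulus s r) \<in> lmeasurable"
    and "measure lebesgue (hcyl xi (C \<inter> annulus s r))
      = (r ^ (CARD('n) - 1) - s ^ (CARD('n) - 1)) * measure lebesgue (hcyl xi (C \<inter> cball 0 1))"
proof -
  have comp: "compact (C \<inter> cball 0 t)" for t
    using cl by (simp add: closed_Int_compact)
  then have lm: "hcyl xi (C \<inter> cball 0 t) \<in> lmeasurable" for t
    using compact_hcyl[OF xi] lmeasurable_compact by blast
  have "C \<inter> annulus s r = C \<inter> cball 0 r - C \<inter> cball 0 s" by (auto simp: annulus_def)
  then have eq: "hcyl xi (C \<inter> annulus s r) = hcyl xi (C \<inter> cball 0 r) - hcyl xi (C \<inter> cball 0 s)"
    by (simp only: hcyl_Diff)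
  have sub: "hcyl xi (C \<inter> cball 0 s) \<subseteq> hcyl xi (C \<inter> cball 0 r)"
    using sr by (intro hcyl_mono) auto
  have m: "measure lebesgue (hcyl xi (C \<inter> cball 0 t)) = t ^ (CARD('n) - 1) * measure lebesgue (hcyl xi (C \<inter> cball 0 1))" if "t > 0" for t
    using cone_Int_cball_scale[OF C that] measure_hcyl_scale[OF xi comp that] by simp
  show "hcyl xi (C \<inter> annulus s r) \<in> lmeasurable"
    unfolding eq using lm by (simp add: fmeasurable.Diff)
  have "measure lebesgue (hcyl xi (C \<inter> annulus s r))
      = measure lebesgue (hcyl xi (C \<inter> cball 0 r)) - measure lebesgue (hcyl xi (C \<inter> cball 0 s))"
    unfolding eq using lm sub by (intro measurable_measure_Diff) (auto simp: fmeasurableD)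
  then show "measure lebesgue (hcyl xi (C \<inter> annulus s r))
      = (r ^ (CARD('n) - 1) - s ^ (CARD('n) - 1)) * measure lebesgue (hcyl xi (C \<inter> cball 0 1))"
    using m[of r] m[of s] sr by (simp add: algebra_simps)
qed

section \<open>The counterexample\<close>

text \<open>A centred Poincare ball is a centred Klein ball, which brings the bodies into the form
  of \<open>hconvex_klein_vimage\<close>. The factor \<open>ball 0 1\<close> matters because
  \<open>klein\<close> takes equal values at points inverse to each other in the unit
  sphere.\<close>

lemma cball_Int_klein_vimage:
  assumes "0 \<le> r" "r < 1"
  shows "cball 0 r \<inter> klein -` C = ball 0 1 \<inter> klein -` (cball 0 (klein_radius r) \<inter> C)"
proof -
  have "norm x \<le> r \<longleftrightarrow> norm x < 1 \<and> klein_radius (norm x) \<le> klein_radius r" for x :: "real^'a"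
    using assms klein_radius_le_iff[of "norm x" r] by force
  then show ?thesis by (auto simp: set_eq_iff norm_klein)
qed

lemma hconvex_cball_klein_vimage:
  assumes "0 \<le> r" "r < 1" "convex C"
  shows "hconvex (cball 0 r \<inter> klein -` C)"
  unfolding cball_Int_klein_vimage[OF assms(1,2)]
  by (intro hconvex_klein_vimage convex_Int convex_cball assms)

lemma compact_cball_klein_vimage: "closed C \<Longrightarrow> compact (cball 0 r \<inter> klein -` C)"
  by (intro compact_Int_closed compact_cball continuous_closed_vimage)
     (use continuous_on_klein continuous_on_eq_continuous_at[of UNIV] in auto)

lemma hbody_cball_klein_vimage:
  assumes r: "0 < r" "r < 1" and C: "closed C" and a: "0 < a" "cball 0 a \<subseteq> C"
  shows "hbody (cball 0 r \<inter> klein -` C)"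
proof -
  \<comment> \<open>The radius a/2 suffices because \<open>klein\<close> at most doubles
    norms.\<close>
  have "ball 0 (min r (a/2)) \<subseteq> cball 0 r \<inter> klein -` C"
  proof
    fix x :: "real^'a" assume "x \<in> ball 0 (min r (a/2))"
    then have x: "norm x < r" "norm x < a/2" by auto
    have "norm (klein x) \<le> 2 * norm x / 1"
      unfolding norm_klein klein_radius_def by (rule divide_left_mono) (auto simp: add_pos_nonneg)
    then have "klein x \<in> cball 0 a" using x by simp
    then show "x \<in> cball 0 r \<inter> klein -` C" using x a by auto
  qed
  then have "ball 0 (min r (a/2)) \<subseteq> interior (cball 0 r \<inter> klein -` C)"
    by (intro interior_maximal open_ball)
  moreover have "0 \<in> ball 0 (min r (a/2))" using r a by simp
  ultimately have "interior (cball 0 r \<inter> klein -` C) \<noteq> {}" by blast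
  moreover have "cball 0 r \<inter> klein -` C \<subseteq> ball 0 1" using r by auto
  ultimately show ?thesis
    using compact_cball_klein_vimage[OF C] unfolding hbody_def by blast
qed

lemma centrally_symmetric_cball_klein_vimage:
  assumes "\<And>x. x \<in> C \<Longrightarrow> - x \<in> C"
  shows "centrally_symmetric (cball 0 r \<inter> klein -` C)"
proof -
  have "- x \<in> cball 0 r \<inter> klein -` C" if "x \<in> cball 0 r \<inter> klein -` C" for x
    using that assms by (auto simp: klein_minus)
  then show ?thesis
    unfolding centrally_symmetric_def by (metis equation_minus_iff image_eqI image_subsetI subsetI subset_antisym)
qed

section \<open>Location of the added shell and of the removed girdle\<close>

lemma girdled_barrel_eq:
  "girdled_barrel e r t = cball 0 r \<inter> klein -` (slab_body e (3/5) (4/5) \<inter> slab_body e (1/10) (klein_radius t))"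
  by (auto simp: girdled_barrel_def barrel_def)

lemma girdled_barrel_Diff_subset: "girdled_barrel e r t - barrel e s \<subseteq> annulus s r"
  by (auto simp: girdled_barrel_def barrel_def annulus_def)

lemma polar_annulus_subset:
  assumes "norm e = 1" "r < 1" "9/20 \<le> t" "t < 1"
  shows "polar_cone e \<inter> annulus s r \<subseteq> girdled_barrel e r t - barrel e s"
  using polar_cone_subset[of e] klein_radius_waist[OF assms(3,4)] assms
  by (auto simp: girdled_barrel_def barrel_def annulus_def)

text \<open>By \<open>slab_body_polar\<close> points are lost only at latitudes up to 3/5, where the
  wide slabs confine them to Klein radius 4/5; inside radius \<open>t\<close> nothing is lost. Hence
  the density on the girdle stays bounded however close \<open>s\<close> and \<open>r\<close> are to
  1.\<close>

lemma barrel_Diff_subset: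
  assumes e: "norm e = 1" and "s \<le> r" "r < 1" and t: "9/20 \<le> t" "t < 1"
  shows "barrel e s - girdled_barrel e r t \<subseteq> annulus t (1/2)"
proof
  fix x assume x: "x \<in> barrel e s - girdled_barrel e r t"
  then have n: "norm x < 1" and M: "klein x \<in> slab_body e (3/5) (4/5)"
    and E: "klein x \<notin> slab_body e (1/10) (klein_radius t)"
    using assms by (auto simp: barrel_def girdled_barrel_def)
  have "\<bar>klein x \<bullet> e\<bar> \<le> 3/5 * norm (klein x)"
    using slab_body_polar[OF e M norm_klein_le_1] E klein_radius_waist[OF t] by blast
  then have "norm (klein x) \<le> klein_radius (1/2)"
    using slab_body_norm_le[OF M] by (simp add: klein_radius_half)
  then have "norm x \<le> 1/2"
    using klein_radius_le_iff[of "norm x" "1/2"] n by (simp add: norm_klein)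
  moreover have "\<not> norm x \<le> t"
  proof
    assume "norm x \<le> t"
    then have "klein_radius (norm x) \<le> klein_radius t" using klein_radius_le_iff[of "norm x" t] n t by simp
    then have "klein x \<in> cball 0 (klein_radius t)" by (simp add: norm_klein)
    then show False using E cball_subset_slab_body by blast
  qed
  ultimately show "x \<in> annulus t (1/2)" by (simp add: annulus_def)
qed

text \<open>The barrel contains the ball of radius 1/2, while inside the equatorial cone the
  tightened slabs leave only radius \<open>t\<close>.\<close>

lemma equatorial_annulus_subset:
  assumes "1/2 \<le> s" "0 \<le> t" "t < 1"
  shows "equatorial_cone e \<inter> annulus t (1/2) \<subseteq> barrel e s - girdled_barrel e r t"
proof
  fix x assume "x \<in> equatorial_cone e \<inter> annulus t (1/2)"
  then have x: "\<bar>x \<bullet> e\<bar> \<le> 1/10 * norm x" "t < norm x" "norm x \<le> 1/2"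
    by (auto simp: equatorial_cone_def annulus_def)
  have "norm (klein x) \<le> 4/5"
    using klein_radius_le_iff[of "norm x" "1/2"] x by (simp add: norm_klein klein_radius_half)
  then have "klein x \<in> slab_body e (3/5) (4/5)"
    using cball_subset_slab_body[of "4/5" e "3/5"] by auto
  then have "x \<in> barrel e s" using x assms by (simp add: barrel_def)
  moreover have kt: "klein_radius t \<ge> 0" using assms by (simp add: klein_radius_def)
  have "x \<notin> girdled_barrel e r t"
  proof
    assume "x \<in> girdled_barrel e r t"
    then have "klein x \<in> slab_body e (1/10) (klein_radius t)" by (simp add: girdled_barrel_def)
    then have "norm (klein x) \<le> klein_radius t"
      using slab_body_norm_le klein_latitude[of x e "1/10"] x(1) kt by blast
    then show False
      using klein_radius_le_iff[of "norm x" t] x assms by (simp add: norm_klein)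
  qed
  ultimately show "x \<in> barrel e s - girdled_barrel e r t" by simp
qed

section \<open>Scaling and measure of the two test cones\<close>

lemma polar_cone_scale: "0 < c \<Longrightarrow> c *\<^sub>R x \<in> polar_cone e \<longleftrightarrow> x \<in> polar_cone e"
proof -
  assume c: "0 < c"
  have "c *\<^sub>R x - (c *\<^sub>R x \<bullet> e) *\<^sub>R e = c *\<^sub>R (x - (x \<bullet> e) *\<^sub>R e)"
    by (simp add: scaleR_diff_right)
  then have "c *\<^sub>R x \<in> polar_cone e \<longleftrightarrow> c * norm (x - (x \<bullet> e) *\<^sub>R e) \<le> c * (norm x / 5)"
    using c by (simp add: polar_cone_def)
  then show ?thesis using c by (simp add: polar_cone_def)
qed

lemma equatorial_cone_scale: "0 < c \<Longrightarrow> c *\<^sub>R x \<in> equatorial_cone e \<longleftrightarrow> x \<in> equatorial_cone e"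
proof -
  assume c: "0 < c"
  have "c *\<^sub>R x \<in> equatorial_cone e \<longleftrightarrow> c * \<bar>x \<bullet> e\<bar> \<le> c * (norm x / 10)"
    using c by (simp add: equatorial_cone_def abs_mult)
  then show ?thesis using c by (simp add: equatorial_cone_def)
qed

lemma closed_polar_cone: "closed (polar_cone e)"
  unfolding polar_cone_def by (intro closed_Collect_le continuous_intros) auto

lemma closed_equatorial_cone: "closed (equatorial_cone e)"
  unfolding equatorial_cone_def by (intro closed_Collect_le continuous_intros) auto

lemma measure_ball_pos:
  fixes c :: "'a::euclidean_space"
  assumes "0 < r" shows "0 < measure lebesgue (ball c r)"
  using content_ball_pos[OF assms, of c] by simp

lemma norm_axial_component_le:
  fixes e x :: "'a::real_inner"
  assumes "norm e = 1"
  shows "norm (x - (x \<bullet> e) *\<^sub>R e) \<le> norm x"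
proof (rule power2_le_imp_le)
  have "(norm (x - (x \<bullet> e) *\<^sub>R e))\<^sup>2 \<le> (norm (x - (x \<bullet> e) *\<^sub>R e))\<^sup>2 + (x \<bullet> e)\<^sup>2" by simp
  then show "(norm (x - (x \<bullet> e) *\<^sub>R e))\<^sup>2 \<le> (norm x)\<^sup>2"
    by (simp only: norm_axial[OF assms, of x, symmetric])
qed simp

lemma measure_polar_cone_pos:
  fixes e :: "real^'n"
  assumes e: "norm e = 1"
  shows "0 < measure lebesgue (polar_cone e \<inter> cball 0 1)"
proof -
  have ee: "e \<bullet> e = 1" using e by (simp add: dot_square_norm)
  \<comment> \<open>In this ball norms are at least 9/20 and transverse parts at most 1/20, below a
    fifth of 9/20.\<close>
  have "ball (e /\<^sub>R 2) (1/20) \<subseteq> polar_cone e \<inter> cball 0 1"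
  proof
    fix x assume "x \<in> ball (e /\<^sub>R 2) (1/20)"
    then have d: "norm (x - e /\<^sub>R 2) < 1/20" by (simp add: dist_norm norm_minus_commute)
    have "\<bar>norm x - norm (e /\<^sub>R 2)\<bar> < 1/20"
      using norm_triangle_ineq3[of x "e /\<^sub>R 2"] d by linarith
    then have n: "9/20 \<le> norm x" "norm x \<le> 1"
      unfolding norm_scaleR e abs_less_iff by simp_all
    have "x - (x \<bullet> e) *\<^sub>R e = (x - e /\<^sub>R 2) - ((x - e /\<^sub>R 2) \<bullet> e) *\<^sub>R e"
      by (simp add: inner_diff_left ee algebra_simps)
    then have "norm (x - (x \<bullet> e) *\<^sub>R e) = norm ((x - e /\<^sub>R 2) - ((x - e /\<^sub>R 2) \<bullet> e) *\<^sub>R e)"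
      by (rule arg_cong)
    then have "norm (x - (x \<bullet> e) *\<^sub>R e) \<le> 1/20"
      using norm_axial_component_le[OF e, of "x - e /\<^sub>R 2"] d by linarith
    then show "x \<in> polar_cone e \<inter> cball 0 1" using n by (simp add: polar_cone_def)
  qed
  then have "measure lebesgue (ball (e /\<^sub>R 2) (1/20)) \<le> measure lebesgue (polar_cone e \<inter> cball 0 1)"
    using closed_polar_cone[of e]
    by (intro measure_mono_fmeasurable) (auto intro!: lmeasurable_compact closed_Int_compact)
  then show ?thesis using measure_ball_pos[of "1/20" "e /\<^sub>R 2"] by linarith
qed

text \<open>In dimension at least three every central hyperplane contains an equatorial direction.\<close>

lemma measure_hcyl_equatorial_cone_ge:
  fixes e xi :: "real^'n"
  assumes n: "CARD('n) \<ge> 3" and e: "norm e = 1" and xi: "norm xi = 1"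
  shows "measure lebesgue (ball (0::real^'n) (1/25)) \<le> measure lebesgue (hcyl xi (equatorial_cone e \<inter> cball 0 1))"
proof -
  have "dim {e, xi} \<le> card {e, xi}" by (intro dim_le_card') simp
  also have "\<dots> \<le> 2" by (simp add: card_insert_if)
  finally have "dim {e, xi} < DIM(real^'n)" using n by simp
  then obtain p0 where p0: "p0 \<noteq> 0" "\<And>y. y \<in> span {e, xi} \<Longrightarrow> orthogonal p0 y"
    using orthogonal_to_subspace_exists by blast
  define p where "p = p0 /\<^sub>R norm p0"
  have p: "norm p = 1" "p \<bullet> e = 0" "p \<bullet> xi = 0"
    using p0 p0(2)[of e] p0(2)[of xi] by (auto simp: p_def orthogonal_def span_base)
  have xx: "xi \<bullet> xi = 1" using xi by (simp add: dot_square_norm)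
  \<comment> \<open>The direction \<open>p\<close> is equatorial and lies in the hyperplane; adding
    half of \<open>xi\<close> lifts the centre to the middle height of the cylinder. Radius 1/25
    works since the projection has norm at least 23/50, and a tenth of that exceeds 1/25.\<close>
  define c where "c = p /\<^sub>R 2 + xi /\<^sub>R 2"
  have cxi: "c \<bullet> xi = 1/2" using p xx by (simp add: c_def inner_add_left)
  have "ball c (1/25) \<subseteq> hcyl xi (equatorial_cone e \<inter> cball 0 1)"
  proof
    fix x assume "x \<in> ball c (1/25)"
    then have d: "norm (x - c) < 1/25" by (simp add: dist_norm norm_minus_commute)
    define z where "z = x - (x \<bullet> xi) *\<^sub>R xi"
    have "\<bar>(x - c) \<bullet> xi\<bar> < 1/25" using Cauchy_Schwarz_ineq2[of "x - c" xi] xi d by simp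
    then have h: "0 \<le> x \<bullet> xi" "x \<bullet> xi \<le> 1" unfolding inner_diff_left cxi by linarith+
    have "z - p /\<^sub>R 2 = (x - c) - ((x - c) \<bullet> xi) *\<^sub>R xi"
      unfolding inner_diff_left cxi z_def by (simp add: c_def algebra_simps)
    then have zp: "norm (z - p /\<^sub>R 2) < 1/25"
      using norm_axial_component_le[OF xi, of "x - c"] d by simp
    have "\<bar>norm z - norm (p /\<^sub>R 2)\<bar> < 1/25"
      using norm_triangle_ineq3[of z "p /\<^sub>R 2"] zp by linarith
    then have nz: "23/50 \<le> norm z" "norm z \<le> 1"
      unfolding norm_scaleR p abs_less_iff by simp_all
    have "\<bar>(z - p /\<^sub>R 2) \<bullet> e\<bar> < 1/25" using Cauchy_Schwarz_ineq2[of "z - p /\<^sub>R 2" e] e zp by simp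
    then have "\<bar>z \<bullet> e\<bar> < 1/25" using p by (simp add: inner_diff_left)
    then show "x \<in> hcyl xi (equatorial_cone e \<inter> cball 0 1)"
      using h nz by (simp add: hcyl_def equatorial_cone_def flip: z_def)
  qed
  moreover have "compact (equatorial_cone e \<inter> cball 0 1)"
    by (intro closed_Int_compact closed_equatorial_cone compact_cball)
  ultimately have "measure lebesgue (ball c (1/25)) \<le> measure lebesgue (hcyl xi (equatorial_cone e \<inter> cball 0 1))"
    using compact_hcyl[OF xi] by (intro measure_mono_fmeasurable) (auto intro!: lmeasurable_compact)
  then show ?thesis by (simp add: content_ball)
qed

lemma measure_hcyl_unit_ball_le:
  fixes xi :: "real^'n"
  assumes "norm xi = 1"
  shows "measure lebesgue (hcyl xi (cball 0 1)) \<le> measure lebesgue (cball (0::real^'n) 2)"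
  using hcyl_cball_subset[OF assms, of "cball 0 1" 1] compact_hcyl[OF assms, of "cball 0 1"]
  by (intro measure_mono_fmeasurable) (auto intro!: fmeasurableD lmeasurable_compact)

section \<open>Volume and section estimates\<close>

lemma hyp_density_mono:
  fixes a b :: real
  assumes "0 \<le> a" "a \<le> b" "b < 1"
  shows "2 / (1 - a\<^sup>2) \<le> 2 / (1 - b\<^sup>2)"
proof -
  have "a\<^sup>2 \<le> b\<^sup>2" "b\<^sup>2 < 1" using assms by (auto intro!: power_mono simp: abs_square_less_1)
  then show ?thesis by (intro divide_left_mono) auto
qed

text \<open>The loss is bounded with 8/3, the density at the outer radius 1/2 of the girdle; the
  gain is counted only in the polar cone, with the density at the inner radius \<open>s\<close> of
  the shell.\<close>

lemma hvol_girdled_barrel_ge: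
  fixes e :: "real^'n"
  assumes e: "norm e = 1" and t: "9/20 \<le> t" "t < 1/2" and sr: "1/2 < s" "s \<le> r" "r < 1"
  shows "hvol (barrel e s) - (8/3) ^ CARD('n) * (((1/2) ^ CARD('n) - t ^ CARD('n)) * measure lebesgue (cball (0::real^'n) 1))
    \<le> hvol (girdled_barrel e r t)
      - (2 / (1 - s\<^sup>2)) ^ CARD('n) * ((r ^ CARD('n) - s ^ CARD('n)) * measure lebesgue (polar_cone e \<inter> cball 0 1))"
proof -
  let ?f = "\<lambda>x::real^'n. (2 / (1 - (norm x)\<^sup>2)) ^ CARD('n)"
  have sub: "barrel e s \<union> girdled_barrel e r t \<subseteq> ball 0 1"
    using sr by (auto simp: barrel_def girdled_barrel_def)
  have U: "(annulus t (1/2) :: (real^'n) set) \<in> lmeasurable"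
    "measure lebesgue (annulus t (1/2) :: (real^'n) set) = ((1/2) ^ CARD('n) - t ^ CARD('n)) * measure lebesgue (cball (0::real^'n) 1)"
    using measure_cone_annulus[of "UNIV :: (real^'n) set" t "1/2"] t by auto
  have T: "polar_cone e \<inter> annulus s r \<in> lmeasurable"
    "measure lebesgue (polar_cone e \<inter> annulus s r) = (r ^ CARD('n) - s ^ CARD('n)) * measure lebesgue (polar_cone e \<inter> cball 0 1)"
    using measure_cone_annulus[OF polar_cone_scale closed_polar_cone, of s r e] sr by auto
  have "integral (barrel e s) ?f - (8/3) ^ CARD('n) * measure lebesgue (annulus t (1/2) :: (real^'n) set)
      \<le> integral (girdled_barrel e r t) ?f - (2 / (1 - s\<^sup>2)) ^ CARD('n) * measure lebesgue (polar_cone e \<inter> annulus s r)"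
  proof (rule compact_integral_compare)
    show "compact (barrel e s)" "compact (girdled_barrel e r t)"
      unfolding barrel_def girdled_barrel_eq
      by (intro compact_cball_klein_vimage closed_Int closed_slab_body)+
    have "1 - (norm x)\<^sup>2 \<noteq> 0" if "x \<in> barrel e s \<union> girdled_barrel e r t" for x
      using one_minus_norm_sq_pos[of x] that sub by force
    then show "continuous_on (barrel e s \<union> girdled_barrel e r t) ?f"
      by (intro continuous_intros) auto
    show "0 \<le> ?f x" if "x \<in> barrel e s \<union> girdled_barrel e r t" for x
      using one_minus_norm_sq_pos[of x] that sub by force
    show sU: "barrel e s - girdled_barrel e r t \<subseteq> annulus t (1/2)"
      using barrel_Diff_subset[OF e] sr t by simp
    show "?f x \<le> (8/3) ^ CARD('n)" if "x \<in> barrel e s - girdled_barrel e r t" for x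
    proof (rule power_mono)
      have "norm x \<le> 1/2" using that sU by (auto simp: annulus_def)
      then have "2 / (1 - (norm x)\<^sup>2) \<le> 2 / (1 - (1/2)\<^sup>2)" by (intro hyp_density_mono) auto
      then show "2 / (1 - (norm x)\<^sup>2) \<le> 8/3" by (simp add: power2_eq_square)
      show "0 \<le> 2 / (1 - (norm x)\<^sup>2)" using one_minus_norm_sq_pos[of x] \<open>norm x \<le> 1/2\<close> by simp
    qed
    show "polar_cone e \<inter> annulus s r \<subseteq> girdled_barrel e r t - barrel e s"
      using polar_annulus_subset[OF e] sr t by simp
    show "(2 / (1 - s\<^sup>2)) ^ CARD('n) \<le> ?f x" if "x \<in> polar_cone e \<inter> annulus s r" for x
    proof (rule power_mono)
      show "2 / (1 - s\<^sup>2) \<le> 2 / (1 - (norm x)\<^sup>2)"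
        using that sr by (intro hyp_density_mono) (auto simp: annulus_def)
      show "0 \<le> 2 / (1 - s\<^sup>2)" using one_minus_norm_sq_pos[of s] sr by simp
    qed
  qed (use U T in auto)
  then show ?thesis unfolding hvol_def U(2) T(2) .
qed

text \<open>The gain is bounded by a full shell with the density at \<open>r\<close>, the loss from
  below with density 1 in the equatorial cone. Both bounds are uniform in \<open>xi\<close>, so the
  one inequality \<open>le\<close> serves all sections.\<close>

lemma hsection_vol_girdled_barrel_le:
  fixes e xi :: "real^'n"
  assumes n: "CARD('n) \<ge> 3" and e: "norm e = 1" and xi: "norm xi = 1"
    and t: "9/20 \<le> t" "t < 1/2" and sr: "1/2 < s" "s \<le> r" "r < 1"
    and le: "(2 / (1 - r\<^sup>2)) ^ (CARD('n) - 1) * ((r ^ (CARD('n) - 1) - s ^ (CARD('n) - 1)) * measure lebesgue (cball (0::real^'n) 2))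
      \<le> ((1/2) ^ (CARD('n) - 1) - t ^ (CARD('n) - 1)) * measure lebesgue (ball (0::real^'n) (1/25))"
  shows "hsection_vol (girdled_barrel e r t) xi \<le> hsection_vol (barrel e s) xi"
proof -
  let ?N = "CARD('n) - 1"
  let ?z = "\<lambda>x::real^'n. x - (x \<bullet> xi) *\<^sub>R xi"
  let ?f = "\<lambda>x::real^'n. (2 / (1 - (norm (?z x))\<^sup>2)) ^ ?N"
  let ?K = "girdled_barrel e r t" and ?L = "barrel e s"
  let ?U = "annulus s r :: (real^'n) set" and ?T = "equatorial_cone e \<inter> annulus t (1/2)"
  have sub: "?L \<union> ?K \<subseteq> ball 0 1"
    using sr by (auto simp: barrel_def girdled_barrel_def)
  have z: "?z x \<in> A" if "x \<in> hcyl xi A" for x A using that by (simp add: hcyl_def)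
  have zn: "1 - (norm (?z x))\<^sup>2 > 0" if "x \<in> hcyl xi ?K \<union> hcyl xi ?L" for x
    using z[of x ?K] z[of x ?L] that sub by (intro one_minus_norm_sq_pos) auto
  have U: "hcyl xi ?U \<in> lmeasurable"
    "measure lebesgue (hcyl xi ?U) = (r ^ ?N - s ^ ?N) * measure lebesgue (hcyl xi (cball 0 1))"
    using measure_hcyl_cone_annulus[of UNIV s r xi] xi sr by auto
  have T: "hcyl xi ?T \<in> lmeasurable"
    "measure lebesgue (hcyl xi ?T) = ((1/2) ^ ?N - t ^ ?N) * measure lebesgue (hcyl xi (equatorial_cone e \<inter> cball 0 1))"
    using measure_hcyl_cone_annulus[OF equatorial_cone_scale closed_equatorial_cone _ _ xi, of t "1/2" e] t by auto
  have r1: "1 - r\<^sup>2 > 0" using one_minus_norm_sq_pos[of r] sr by simp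
  have "integral (hcyl xi ?K) ?f - (2 / (1 - r\<^sup>2)) ^ ?N * measure lebesgue (hcyl xi ?U)
      \<le> integral (hcyl xi ?L) ?f - 1 * measure lebesgue (hcyl xi ?T)"
  proof (rule compact_integral_compare)
    show "compact (hcyl xi ?K)" "compact (hcyl xi ?L)"
      unfolding barrel_def girdled_barrel_eq
      by (intro compact_hcyl[OF xi] compact_cball_klein_vimage closed_Int closed_slab_body)+
    show "continuous_on (hcyl xi ?K \<union> hcyl xi ?L) ?f"
      using zn by (intro continuous_intros ballI) fastforce
    show "0 \<le> ?f x" if "x \<in> hcyl xi ?K \<union> hcyl xi ?L" for x
      using zn[OF that] by simp
    show sU: "hcyl xi ?K - hcyl xi ?L \<subseteq> hcyl xi ?U"
      unfolding hcyl_Diff[symmetric] by (intro hcyl_mono girdled_barrel_Diff_subset)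
    show "?f x \<le> (2 / (1 - r\<^sup>2)) ^ ?N" if "x \<in> hcyl xi ?K - hcyl xi ?L" for x
    proof (rule power_mono)
      have "norm (?z x) \<le> r" using z[of x ?U] that sU by (auto simp: annulus_def)
      then show "2 / (1 - (norm (?z x))\<^sup>2) \<le> 2 / (1 - r\<^sup>2)" using sr by (intro hyp_density_mono) auto
      show "0 \<le> 2 / (1 - (norm (?z x))\<^sup>2)" using zn[of x] that by simp
    qed
    show sT: "hcyl xi ?T \<subseteq> hcyl xi ?L - hcyl xi ?K"
      unfolding hcyl_Diff[symmetric] using sr t by (intro hcyl_mono equatorial_annulus_subset) auto
    show "1 \<le> ?f x" if "x \<in> hcyl xi ?T" for x
    proof (rule one_le_power)
      have pos: "1 - (norm (?z x))\<^sup>2 > 0" using zn[of x] that sT by blast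
      have "1 \<le> 2 / (1 - q)" if "1 - q > 0" "0 \<le> q" for q :: real
        using that by (simp add: divide_simps)
      then show "1 \<le> 2 / (1 - (norm (?z x))\<^sup>2)" using pos zero_le_power2 by blast
    qed
    show "0 \<le> (2 / (1 - r\<^sup>2)) ^ ?N" using r1 by simp
  qed (use U T in auto)
  moreover have "(2 / (1 - r\<^sup>2)) ^ ?N * measure lebesgue (hcyl xi ?U) \<le> measure lebesgue (hcyl xi ?T)"
  proof -
    have "(2 / (1 - r\<^sup>2)) ^ ?N * measure lebesgue (hcyl xi ?U)
        \<le> (2 / (1 - r\<^sup>2)) ^ ?N * ((r ^ ?N - s ^ ?N) * measure lebesgue (cball (0::real^'n) 2))"
      unfolding U(2) using r1 sr measure_hcyl_unit_ball_le[OF xi]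
      by (intro mult_left_mono) (auto intro: power_mono)
    also note le
    also have "((1/2) ^ ?N - t ^ ?N) * measure lebesgue (ball (0::real^'n) (1/25)) \<le> measure lebesgue (hcyl xi ?T)"
      unfolding T(2) using t measure_hcyl_equatorial_cone_ge[OF n e xi]
      by (intro mult_left_mono) (auto intro: power_mono)
    finally show ?thesis .
  qed
  ultimately have "integral (hcyl xi ?K) ?f \<le> integral (hcyl xi ?L) ?f" by linarith
  then show ?thesis unfolding hsection_vol_def hcyl_def .
qed

text \<open>The gain near the poles outweighs the loss at the equator because the volume density
  carries one factor \<open>2 / (1 - s\<^sup>2)\<close> more than the section density.\<close>

lemma exists_radii:
  fixes V q w :: real
  assumes N: "N \<noteq> 0" and pos: "0 < V" "0 < q" "0 < w"
  obtains s r t where "1/2 < s" "s < r" "r < 1" "9/20 \<le> t" "t < 1/2"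
    "(2 / (1 - r\<^sup>2)) ^ N * (r ^ N - s ^ N) * q = (1/2) ^ N - t ^ N"
    "(8/3) ^ Suc N * (((1/2) ^ Suc N - t ^ Suc N) * V) < (2 / (1 - s\<^sup>2)) ^ Suc N * ((r ^ Suc N - s ^ Suc N) * w)"
proof -
  \<comment> \<open>Collects the constants of the closing estimate, where
    \<open>(8/3) ^ Suc N * 2 * q * V\<close> equals \<open>M * w / 2\<close>; the extra density
    factor \<open>h\<close> then only has to exceed \<open>M\<close>.\<close>
  define M where "M = 4 * (8/3) ^ Suc N * V * q / w"
  have M: "M > 0" using pos by (simp add: M_def)
  \<comment> \<open>This makes \<open>h\<close> equal to 2 (M + 2); the summand 2 keeps
    \<open>s\<close> above 1/2.\<close>
  define s where "s = sqrt (1 - 1 / (M + 2))"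
  have M2: "1 / (M + 2) < 1 / 2" using M by (intro divide_strict_left_mono) auto
  then have s2: "s\<^sup>2 = 1 - 1 / (M + 2)" by (simp add: s_def)
  have s1: "s < 1" using M by (simp add: s_def)
  have "(1/2)\<^sup>2 < s\<^sup>2" unfolding s2 using M2 by (simp add: power2_eq_square)
  then have sh: "1/2 < s" by (rule power_less_imp_less_base) (use M2 in \<open>simp add: s_def\<close>)
  define h where "h = 2 / (1 - s\<^sup>2)"
  have h: "h > M" using M by (simp add: h_def s2)
  define \<Gamma> where "\<Gamma> r = (2 / (1 - r\<^sup>2)) ^ N * (r ^ N - s ^ N) * q" for r
  have ne: "1 - s\<^sup>2 \<noteq> 0" using M by (simp add: s2)
  have "((\<lambda>r. (2 / (1 - r\<^sup>2)) ^ N) \<longlongrightarrow> h ^ N) (at_right s)"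
    unfolding h_def using ne by (intro tendsto_intros) auto
  moreover have "h ^ N < 2 * h ^ N" using h M by simp
  \<comment> \<open>Three conditions hold for \<open>r\<close> just above \<open>s\<close>: the
    density power at most doubles, the section gain is small enough to leave the waist above 9/20,
    and \<open>r\<close> stays below 1.\<close>
  ultimately have ev1: "\<forall>\<^sub>F r in at_right s. (2 / (1 - r\<^sup>2)) ^ N < 2 * h ^ N"
    by (rule order_tendstoD(2))
  have "(\<Gamma> \<longlongrightarrow> (2 / (1 - s\<^sup>2)) ^ N * (s ^ N - s ^ N) * q) (at_right s)"
    unfolding \<Gamma>_def using ne by (intro tendsto_intros) auto
  moreover have "(9/20 :: real) ^ N < (1/2) ^ N" using N by (intro power_strict_mono) auto
  ultimately have ev2: "\<forall>\<^sub>F r in at_right s. \<Gamma> r < (1/2) ^ N - (9/20) ^ N"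
    by (intro order_tendstoD(2)) auto
  have ev3: "\<forall>\<^sub>F r in at_right s. r \<in> {s<..<1}"
    by (rule eventually_at_right_real[OF s1])
  obtain r where r: "(2 / (1 - r\<^sup>2)) ^ N < 2 * h ^ N" "\<Gamma> r < (1/2) ^ N - (9/20) ^ N" "s < r" "r < 1"
    using eventually_happens'[OF _ eventually_conj[OF ev1 eventually_conj[OF ev2 ev3]]]
    by (auto simp: trivial_limit_at_right_real)
  define \<Delta> where "\<Delta> = r ^ N - s ^ N"
  have \<Delta>: "\<Delta> > 0" unfolding \<Delta>_def using r sh N by (simp add: power_strict_mono)
  have "1 - r\<^sup>2 > 0" using one_minus_norm_sq_pos[of r] r sh by simp
  then have G0: "\<Gamma> r > 0" unfolding \<Gamma>_def \<Delta>_def[symmetric] using \<Delta> pos by simp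
  \<comment> \<open>Solves the balance of section gain and section loss exactly.\<close>
  define t where "t = root N ((1/2) ^ N - \<Gamma> r)"
  have G1: "(1/2) ^ N - \<Gamma> r > (9/20) ^ N" using r by simp
  then have G2: "(1/2) ^ N - \<Gamma> r > 0"
    using zero_less_power[of "9/20 :: real" N] by linarith
  have tN: "t ^ N = (1/2) ^ N - \<Gamma> r" unfolding t_def using N G2 by (simp add: real_root_pow_pos2)
  have t0: "t \<ge> 0" unfolding t_def using N G2 by simp
  have t1: "9/20 < t" using G1 t0 unfolding tN[symmetric] by (rule power_less_imp_less_base)
  have "t ^ N < (1/2) ^ N" unfolding tN using G0 by simp
  then have t2: "t < 1/2" by (rule power_less_imp_less_base) simp
  \<comment> \<open>The loss of degree \<open>Suc N\<close> splits into half the loss of degree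
    \<open>N\<close> and this term, so it is at most the loss of degree \<open>N\<close>.\<close>
  have "(1/2 - t) * t ^ N \<le> 1/2 * \<Gamma> r"
  proof -
    obtain m where m: "N = Suc m" using N by (cases N) auto
    have "t ^ m \<le> (1/2) ^ m" using t0 t2 by (intro power_mono) auto
    then have "t * t ^ m \<le> t * (1/2) ^ m" using t0 by (intro mult_left_mono)
    then have "(1/2 - t) * (1/2) ^ m \<le> \<Gamma> r" using tN unfolding m by (simp add: algebra_simps)
    moreover have "t ^ N \<le> (1/2) ^ N" using t0 t2 by (intro power_mono) auto
    then have "(1/2 - t) * t ^ N \<le> (1/2 - t) * (1/2) ^ N" using t2 by (intro mult_left_mono) auto
    ultimately show ?thesis unfolding m by simp
  qed
  moreover have "(1/2) ^ Suc N - t ^ Suc N = 1/2 * \<Gamma> r + (1/2 - t) * t ^ N"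
    using tN by (simp add: algebra_simps)
  ultimately have lossN: "(1/2) ^ Suc N - t ^ Suc N \<le> \<Gamma> r" by linarith
  \<comment> \<open>Bounding one factor \<open>r\<close> below by \<open>s\<close> gives s times the
    difference of degree \<open>N\<close>, and s > 1/2.\<close>
  have gain: "\<Delta> / 2 \<le> r ^ Suc N - s ^ Suc N"
  proof -
    have "1/2 * \<Delta> \<le> s * \<Delta>" using sh \<Delta> by simp
    moreover have "s * \<Delta> = s * r ^ N - s ^ Suc N" by (simp add: \<Delta>_def right_diff_distrib)
    moreover have "s * r ^ N \<le> r ^ Suc N" using r sh by (simp add: mult_right_mono)
    ultimately show ?thesis by linarith
  qed
  have hN: "h ^ N * \<Delta> > 0" using h M \<Delta> by simp
  have "(8/3) ^ Suc N * (((1/2) ^ Suc N - t ^ Suc N) * V) \<le> (8/3) ^ Suc N * (\<Gamma> r * V)"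
    using lossN pos by (intro mult_left_mono mult_right_mono) auto
  also have "\<dots> \<le> (8/3) ^ Suc N * ((2 * h ^ N * \<Delta> * q) * V)"
    unfolding \<Gamma>_def \<Delta>_def[symmetric] using r(1) \<Delta> pos
    by (intro mult_left_mono mult_right_mono) auto
  also have "\<dots> = (h ^ N * \<Delta>) * (M * w / 2)"
    using pos by (simp add: M_def)
  also have "\<dots> < (h ^ N * \<Delta>) * (h * w / 2)"
    using hN h pos by (intro mult_strict_left_mono) auto
  also have "\<dots> = h ^ Suc N * (\<Delta> / 2 * w)" by simp
  also have "\<dots> \<le> h ^ Suc N * ((r ^ Suc N - s ^ Suc N) * w)"
    using gain h M pos by (intro mult_left_mono mult_right_mono) auto
  finally show ?thesis
    using that[of s r t] sh r t1 t2 tN unfolding h_def \<Gamma>_def by simp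
qed

theorem theorem2:
  assumes "CARD('n) \<ge> 3"
  shows "\<exists>K L :: (real^'n) set.
           hbody K \<and> hbody L \<and> hconvex K \<and> hconvex L \<and>
           centrally_symmetric K \<and> centrally_symmetric L \<and>
           (\<forall>xi :: real^'n. norm xi = 1 \<longrightarrow> hsection_vol K xi \<le> hsection_vol L xi) \<and>
           hvol K > hvol L"
proof -
  obtain e :: "real^'n" where e: "norm e = 1" using vector_choose_size[of 1] by auto
  define N where "N = CARD('n) - 1"
  have N: "CARD('n) = Suc N" "N \<noteq> 0" using assms by (auto simp: N_def)
  define V where "V = measure lebesgue (cball (0::real^'n) 1)"
  define V2 where "V2 = measure lebesgue (cball (0::real^'n) 2)"
  define v where "v = measure lebesgue (ball (0::real^'n) (1/25))"
  define w where "w = measure lebesgue (polar_cone e \<inter> cball 0 1)"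
  have "V > 0" "V2 > 0" "v > 0" "w > 0"
    using measure_polar_cone_pos[OF e] measure_ball_pos[of _ "0::real^'n"]
      content_cball_pos[of _ "0::real^'n"]
    by (simp_all add: V_def V2_def v_def w_def)
  \<comment> \<open>The ratio \<open>V2 / v\<close> compares the upper bound for cylinders over the
    unit ball with the lower bound for those over the equatorial cone.\<close>
  then obtain s r t where sr: "1/2 < s" "s < r" "r < 1" and t: "9/20 \<le> t" "t < 1/2"
    and sec: "(2 / (1 - r\<^sup>2)) ^ N * (r ^ N - s ^ N) * (V2 / v) = (1/2) ^ N - t ^ N"
    and vol: "(8/3) ^ Suc N * (((1/2) ^ Suc N - t ^ Suc N) * V) < (2 / (1 - s\<^sup>2)) ^ Suc N * ((r ^ Suc N - s ^ Suc N) * w)"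
    using exists_radii[OF N(2), of V "V2 / v" w] by auto
  let ?K = "girdled_barrel e r t" and ?L = "barrel e s"
  have kt: "klein_radius t \<ge> 7/10" using klein_radius_waist t by simp
  \<comment> \<open>A common Klein ball inside all slabs supplies the interior points of both
    bodies.\<close>
  have "cball 0 (7/10) \<subseteq> cball (0::real^'n) (klein_radius t)" "cball 0 (7/10) \<subseteq> cball (0::real^'n) (4/5)"
    using kt by auto
  then have core: "cball 0 (7/10) \<subseteq> slab_body e (1/10) (klein_radius t)" "cball 0 (7/10) \<subseteq> slab_body e (3/5) (4/5)"
    using cball_subset_slab_body by blast+
  have "hbody ?K" "hbody ?L"
    unfolding girdled_barrel_eq barrel_def using sr core
    by (intro hbody_cball_klein_vimage[where a = "7/10"] closed_Int closed_slab_body; simp)+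
  moreover have "hconvex ?K" "hconvex ?L"
    unfolding girdled_barrel_eq barrel_def using sr
    by (intro hconvex_cball_klein_vimage convex_Int convex_slab_body; simp)+
  moreover have "centrally_symmetric ?K" "centrally_symmetric ?L"
    unfolding girdled_barrel_eq barrel_def
    by (intro centrally_symmetric_cball_klein_vimage; auto intro: uminus_slab_body)+
  moreover have "hsection_vol ?K xi \<le> hsection_vol ?L xi" if "norm xi = 1" for xi
  proof (rule hsection_vol_girdled_barrel_le[OF assms e that t sr(1) _ sr(3)])
    have "(2 / (1 - r\<^sup>2)) ^ N * ((r ^ N - s ^ N) * V2) = ((1/2) ^ N - t ^ N) * v"
      unfolding sec[symmetric] using \<open>v > 0\<close> by simp
    then show "(2 / (1 - r\<^sup>2)) ^ (CARD('n) - 1) * ((r ^ (CARD('n) - 1) - s ^ (CARD('n) - 1)) * measure lebesgue (cball (0::real^'n) 2))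
        \<le> ((1/2) ^ (CARD('n) - 1) - t ^ (CARD('n) - 1)) * measure lebesgue (ball (0::real^'n) (1/25))"
      unfolding N_def V2_def v_def by simp
  qed (use sr in simp)
  moreover have "hvol ?K > hvol ?L"
    using hvol_girdled_barrel_ge[OF e t sr(1) _ sr(3)] sr vol unfolding N V_def w_def by fastforce
  ultimately show ?thesis by blast
qed

end
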